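(* Let $n\ge1$. The integer $r=\lfloor n/2\rfloor+1$ is the smallest integer such that every generic $n\times n$ complex matrix is a product of $r$ Hankel matrices.
   Context: A Hankel matrix is an $n\times n$ complex matrix $(h_{ij})$ with $h_{ij}=h_{i'j'}$ whenever $i+j=i'+j'$. "Every generic $n\times n$ matrix has property $P$" means that the Zariski closure of the set of matrices in $\mathbb{C}^{n\times n}\simeq\mathbb{C}^{n^2}$ not having property $P$ is a proper closed subset of $\mathbb{C}^{n\times n}$. All Hankel factors are $n\times n$ with complex entries. *)

theory Defs
  imports Complex_Main "Jordan_Normal_Form.Matrix"
begin

definition hankel_mat :: "nat \<Rightarrow> complex mat \<Rightarrow> bool" where
  "hankel_mat n H \<longleftrightarrow> H \<in> carrier_mat n n \<and>
     (\<forall>i < n. \<forall>j < n. \<forall>i' < n. \<forall>j' < n. i + j = i' + j' \<longrightarrow> H $$ (i, j) = H $$ (i', j'))"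

definition hankel_product :: "nat \<Rightarrow> nat \<Rightarrow> complex mat \<Rightarrow> bool" where
  "hankel_product n r A \<longleftrightarrow>
     (\<exists>Hs. length Hs = r \<and> (\<forall>H \<in> set Hs. hankel_mat n H) \<and> A = foldr (*) Hs (1\<^sub>m n))"

text \<open>
  The coordinate ring of affine space \<open>\<complex>\<^bsup>n\<times>n\<^esup>\<close>: since the ground field is infinite, polynomials in
  the \<open>n\<^sup>2\<close> entries may be identified with the functions they induce. The index bounds are
  needed because entries outside the dimensions of a matrix are unspecified.
\<close>

inductive mat_polynomial_function :: "nat \<Rightarrow> (complex mat \<Rightarrow> complex) \<Rightarrow> bool" for n where
  entry: "i < n \<Longrightarrow> j < n \<Longrightarrow> mat_polynomial_function n (\<lambda>A. A $$ (i, j))"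
| const: "mat_polynomial_function n (\<lambda>A. c)"
| add: "mat_polynomial_function n f \<Longrightarrow> mat_polynomial_function n g \<Longrightarrow>
    mat_polynomial_function n (\<lambda>A. f A + g A)"
| mult: "mat_polynomial_function n f \<Longrightarrow> mat_polynomial_function n g \<Longrightarrow>
    mat_polynomial_function n (\<lambda>A. f A * g A)"

definition zariski_closed :: "nat \<Rightarrow> complex mat set \<Rightarrow> bool" where
  "zariski_closed n Z \<longleftrightarrow>
     (\<exists>F. (\<forall>f \<in> F. mat_polynomial_function n f) \<and> Z = {A \<in> carrier_mat n n. \<forall>f \<in> F. f A = 0})"

definition zariski_closure :: "nat \<Rightarrow> complex mat set \<Rightarrow> complex mat set" where
  "zariski_closure n S = zariski_closed n hull S"

lemma zariski_closed_Inter: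
  assumes "\<Z> \<noteq> {}" and "\<And>Z. Z \<in> \<Z> \<Longrightarrow> zariski_closed n Z"
  shows "zariski_closed n (\<Inter>\<Z>)"
proof -
  from assms(2) have "\<forall>Z \<in> \<Z>. \<exists>F. (\<forall>f \<in> F. mat_polynomial_function n f) \<and>
      Z = {A \<in> carrier_mat n n. \<forall>f \<in> F. f A = 0}"
    unfolding zariski_closed_def by blast
  from bchoice[OF this] obtain F where F: "\<forall>Z \<in> \<Z>. (\<forall>f \<in> F Z. mat_polynomial_function n f) \<and>
      Z = {A \<in> carrier_mat n n. \<forall>f \<in> F Z. f A = 0}" ..
  have eq: "\<And>A Z. Z \<in> \<Z> \<Longrightarrow> A \<in> Z \<longleftrightarrow> A \<in> carrier_mat n n \<and> (\<forall>f \<in> F Z. f A = 0)"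
    using F by blast
  have "\<Inter>\<Z> = {A \<in> carrier_mat n n. \<forall>f \<in> (\<Union>Z \<in> \<Z>. F Z). f A = 0}"
    using eq assms(1) by auto
  moreover have "\<forall>f \<in> (\<Union>Z \<in> \<Z>. F Z). mat_polynomial_function n f"
    using F by blast
  ultimately show ?thesis
    unfolding zariski_closed_def by blast
qed

lemma zariski_closed_carrier: "zariski_closed n (carrier_mat n n)"
  unfolding zariski_closed_def by (rule exI[of _ "{}"]) simp

lemma zariski_closed_closure:
  assumes "S \<subseteq> carrier_mat n n"
  shows "zariski_closed n (zariski_closure n S)"
  unfolding zariski_closure_def hull_def
  by (rule zariski_closed_Inter) (use assms zariski_closed_carrier in auto)

text \<open>
  The closure is automatically closed (lemma \<open>zariski_closed_closure\<close>), so being a proper closed subset amounts to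
  being a proper subset.
\<close>

definition every_generic_mat :: "nat \<Rightarrow> (complex mat \<Rightarrow> bool) \<Rightarrow> bool" where
  "every_generic_mat n P \<longleftrightarrow>
     zariski_closure n {A \<in> carrier_mat n n. \<not> P A} \<subset> carrier_mat n n"

end

theory Submission
  imports Defs
    "HOL-Library.FuncSet"
    "HOL-Computational_Algebra.Fundamental_Theorem_Algebra"
    "Jordan_Normal_Form.Determinant"
begin

text \<open>
  A Hankel matrix is determined by its \<open>2n - 1\<close> antidiagonal values, so multiplying \<open>r\<close> Hankel
  matrices is a polynomial map from \<open>\<complex>\<^bsup>r(2n-1)\<^esup>\<close> to the \<open>n\<^sup>2\<close>-dimensional space of matrices, and
  the property is generic iff the image contains a nonempty Zariski open set
  (\<open>every_generic_mat_iff\<close>).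

  Too few factors: if \<open>s \<le> n/2\<close> then \<open>s(2n - 1) < n\<^sup>2\<close>, so the entries of the product satisfy a
  nontrivial polynomial relation (\<open>algebraically_dependent\<close>). The products then lie on a
  hypersurface, which cannot contain a nonempty open set.

  Enough factors, \<open>r = \<lfloor>n/2\<rfloor> + 1\<close>: by elimination theory the set of products is constructible
  (\<open>constructible_ex\<close>), hence it contains a nonempty open set or is disjoint from one
  (\<open>constructible_generic_dichotomy\<close>). It remains to exclude the second case, that is, to show
  that no nonzero polynomial vanishes on all products (\<open>hankel_products_dense\<close>). If the product
  map has a surjective differential at some point, then curves through its value leave that value
  in all directions, and a nonzero polynomial vanishing on the image would have a lowest
  homogeneous part there that vanishes in all directions (\<open>poly_fun_zero_if_vanishes_along_curves\<close>).

  To find such a point, flip columns or rows so as to replace Hankel by Toeplitz factors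
  (\<open>toeplitz_product_is_hankel_product\<close>), and take the factors
  \<open>T\<^sub>k = 1 + \<epsilon>\<^bsup>k+1\<^esup> B\<^sub>k\<close>, where \<open>B\<^sub>k\<close> has ones exactly on the two diagonals at distance
  \<open>b = n - 1 - k\<close> from the main one.
  Perturbing \<open>T\<^sub>0\<close> alone by a Toeplitz matrix \<open>S\<close> moves the product, as \<open>\<epsilon> \<rightarrow> 0\<close>, in the direction
  \<open>S\<close>. Perturbing \<open>T\<^sub>k\<close> by \<open>-S/\<epsilon>\<^bsup>k+1\<^esup>\<close> and \<open>T\<^bsub>k+1\<^esub>\<close> by \<open>S/\<epsilon>\<^bsup>k+1\<^esup>\<close> cancels the leading terms and
  leaves the direction \<open>B\<^sub>k S\<close> (\<open>limit_direction_shift_pair\<close>).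
  On every diagonal, the Toeplitz matrices and the products \<open>B\<^sub>k S\<close> with \<open>k < \<lfloor>n/2\<rfloor>\<close> generate
  all truncations of the constant diagonal (\<open>limit_direction_diagonal_tail\<close>), hence all matrix
  units, and spanning survives for some \<open>\<epsilon>\<close> because a determinant is continuous
  (\<open>perturbed_basis_spans\<close>).
\<close>

section \<open>Polynomial functions\<close>

text \<open>
  Points are functions on an arbitrary type of variables; the set \<open>V\<close> records which coordinates a
  polynomial may read. Coordinates can thus be eliminated without changing the type.
\<close>

inductive poly_fun :: "'v set \<Rightarrow> (('v \<Rightarrow> complex) \<Rightarrow> complex) \<Rightarrow> bool" for V where
  var: "v \<in> V \<Longrightarrow> poly_fun V (\<lambda>x. x v)"
| const: "poly_fun V (\<lambda>x. c)"
| add: "poly_fun V f \<Longrightarrow> poly_fun V g \<Longrightarrow> poly_fun V (\<lambda>x. f x + g x)"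
| mult: "poly_fun V f \<Longrightarrow> poly_fun V g \<Longrightarrow> poly_fun V (\<lambda>x. f x * g x)"

lemma poly_fun_minus: "poly_fun V f \<Longrightarrow> poly_fun V g \<Longrightarrow> poly_fun V (\<lambda>x. f x - g x)"
  using poly_fun.add[of V f "\<lambda>x. -1 * g x"] poly_fun.mult[OF poly_fun.const[of V "-1"], of g] by simp

lemma poly_fun_sum:
  assumes "\<And>i. i \<in> I \<Longrightarrow> poly_fun V (f i)"
  shows "poly_fun V (\<lambda>x. \<Sum>i\<in>I. f i x)"
  using assms by (induction I rule: infinite_finite_induct) (auto intro: poly_fun.intros)

lemma poly_fun_prod:
  assumes "\<And>i. i \<in> I \<Longrightarrow> poly_fun V (f i)"
  shows "poly_fun V (\<lambda>x. \<Prod>i\<in>I. f i x)"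
  using assms by (induction I rule: infinite_finite_induct) (auto intro: poly_fun.intros)

lemma poly_fun_power: "poly_fun V f \<Longrightarrow> poly_fun V (\<lambda>x. f x ^ k)"
  using poly_fun_prod[of "{..<k}" V "\<lambda>_. f"] by simp

lemma poly_fun_cong_vars:
  assumes "poly_fun V f" "\<And>v. v \<in> V \<Longrightarrow> x v = y v"
  shows "f x = f y"
  using assms by (induction) auto

lemma poly_fun_along_line:
  assumes "poly_fun V f"
  shows "\<exists>p. \<forall>t. f (\<lambda>v. x v + t * y v) = poly p t"
  using assms
proof induction
  case (var v)
  show ?case by (rule exI[of _ "[:x v, y v:]"]) (simp add: algebra_simps)
next
  case (const c)
  show ?case by (rule exI[of _ "[:c:]"]) simp
next
  case (add f g)
  then show ?case by (metis poly_add)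
next
  case (mult f g)
  then show ?case by (metis poly_mult)
qed

text \<open>
  Join a point where \<open>f\<close> is nonzero to one where \<open>g\<close> is nonzero by a line. On it both are nonzero
  polynomials in one variable, and so is their product.
\<close>

lemma poly_fun_mult_nonzero:
  assumes "poly_fun V f" "poly_fun V g" "f x \<noteq> 0" "g y \<noteq> 0"
  shows "\<exists>z. f z * g z \<noteq> 0"
proof (rule ccontr)
  assume *: "\<not> ?thesis"
  obtain p where p: "\<And>t. f (\<lambda>v. x v + t * (y v - x v)) = poly p t"
    using poly_fun_along_line[OF assms(1), of x "\<lambda>v. y v - x v"] by blast
  obtain q where q: "\<And>t. g (\<lambda>v. x v + t * (y v - x v)) = poly q t"
    using poly_fun_along_line[OF assms(2), of x "\<lambda>v. y v - x v"] by blast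
  have "poly (p * q) t = 0" for t
    using * unfolding poly_mult p[symmetric] q[symmetric] by blast
  hence "p * q = 0" using poly_all_0_iff_0 by blast
  moreover have "poly p 0 \<noteq> 0" using assms(3) p[of 0] by simp
  moreover have "poly q 1 \<noteq> 0" using assms(4) q[of 1] by simp
  ultimately show False by auto
qed

section \<open>Constructible conditions\<close>

text \<open>
  The positive Boolean combinations of equations and inequations. This form is reproduced when an
  existential quantifier, pushed through disjunctions, is eliminated.
\<close>

inductive constructible :: "'v set \<Rightarrow> (('v \<Rightarrow> complex) \<Rightarrow> bool) \<Rightarrow> bool" for V where
  eq: "poly_fun V f \<Longrightarrow> constructible V (\<lambda>x. f x = 0)"
| neq: "poly_fun V f \<Longrightarrow> constructible V (\<lambda>x. f x \<noteq> 0)"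
| conj: "constructible V \<phi> \<Longrightarrow> constructible V \<psi> \<Longrightarrow> constructible V (\<lambda>x. \<phi> x \<and> \<psi> x)"
| disj: "constructible V \<phi> \<Longrightarrow> constructible V \<psi> \<Longrightarrow> constructible V (\<lambda>x. \<phi> x \<or> \<psi> x)"

lemma constructible_False: "constructible V (\<lambda>x. False)"
  using constructible.eq[OF poly_fun.const[of V 1]] by simp

lemma constructible_True: "constructible V (\<lambda>x. True)"
  using constructible.eq[OF poly_fun.const[of V 0]] by simp

lemma constructible_Ball:
  assumes "finite I" "\<And>i. i \<in> I \<Longrightarrow> constructible V (\<phi> i)"
  shows "constructible V (\<lambda>x. \<forall>i\<in>I. \<phi> i x)"
  using assms by (induction I) (auto intro: constructible.conj constructible_True)

lemma constructible_Bex: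
  assumes "finite I" "\<And>i. i \<in> I \<Longrightarrow> constructible V (\<phi> i)"
  shows "constructible V (\<lambda>x. \<exists>i\<in>I. \<phi> i x)"
  using assms by (induction I) (auto intro: constructible.disj constructible_False)

text \<open>
  This is irreducibility of affine space: any two nonempty open sets meet
  (\<open>poly_fun_mult_nonzero\<close>), so truth values that are constant on open sets can be combined.
\<close>

lemma constructible_generic_dichotomy:
  assumes "constructible V \<phi>"
  shows "\<exists>f x0. poly_fun V f \<and> f x0 \<noteq> 0 \<and>
    ((\<forall>x. f x \<noteq> 0 \<longrightarrow> \<phi> x) \<or> (\<forall>x. f x \<noteq> 0 \<longrightarrow> \<not> \<phi> x))"
  using assms
proof induction
  case (eq f)
  show ?case
  proof (cases "\<forall>x. f x = 0")
    case True
    then show ?thesis by (intro exI[of _ "\<lambda>x. 1"]) (auto intro: poly_fun.const)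
  next
    case False
    then show ?thesis using eq by (intro exI[of _ f]) auto
  qed
next
  case (neq f)
  show ?case
  proof (cases "\<forall>x. f x = 0")
    case True
    then show ?thesis by (intro exI[of _ "\<lambda>x. 1"]) (auto intro: poly_fun.const)
  next
    case False
    then show ?thesis using neq by (intro exI[of _ f]) auto
  qed
next
  case (conj \<phi> \<psi>)
  from conj.IH(1) obtain f x0 where
    f: "poly_fun V f" "f x0 \<noteq> 0" "(\<forall>x. f x \<noteq> 0 \<longrightarrow> \<phi> x) \<or> (\<forall>x. f x \<noteq> 0 \<longrightarrow> \<not> \<phi> x)"
    by (elim exE conjE) (rule that)
  from conj.IH(2) obtain g y0 where
    g: "poly_fun V g" "g y0 \<noteq> 0" "(\<forall>x. g x \<noteq> 0 \<longrightarrow> \<psi> x) \<or> (\<forall>x. g x \<noteq> 0 \<longrightarrow> \<not> \<psi> x)"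
    by (elim exE conjE) (rule that)
  obtain z0 where z0: "f z0 * g z0 \<noteq> 0"
    using poly_fun_mult_nonzero[where f = f and g = g and x = x0 and y = y0] f g by blast
  show ?case
    by (rule exI[of _ "\<lambda>x. f x * g x"], rule exI[of _ z0])
      (use z0 f(3) g(3) poly_fun.mult[OF f(1) g(1)] in auto)
next
  case (disj \<phi> \<psi>)
  from disj.IH(1) obtain f x0 where
    f: "poly_fun V f" "f x0 \<noteq> 0" "(\<forall>x. f x \<noteq> 0 \<longrightarrow> \<phi> x) \<or> (\<forall>x. f x \<noteq> 0 \<longrightarrow> \<not> \<phi> x)"
    by (elim exE conjE) (rule that)
  from disj.IH(2) obtain g y0 where
    g: "poly_fun V g" "g y0 \<noteq> 0" "(\<forall>x. g x \<noteq> 0 \<longrightarrow> \<psi> x) \<or> (\<forall>x. g x \<noteq> 0 \<longrightarrow> \<not> \<psi> x)"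
    by (elim exE conjE) (rule that)
  obtain z0 where z0: "f z0 * g z0 \<noteq> 0"
    using poly_fun_mult_nonzero[where f = f and g = g and x = x0 and y = y0] f g by blast
  show ?case
    by (rule exI[of _ "\<lambda>x. f x * g x"], rule exI[of _ z0])
      (use z0 f(3) g(3) poly_fun.mult[OF f(1) g(1)] in auto)
qed

lemma bex_Times: "(\<exists>z \<in> A \<times> B. P z) \<longleftrightarrow> (\<exists>a\<in>A. \<exists>b\<in>B. P (a, b))"
  by auto

text \<open>
  Several inequations \<open>q \<noteq> 0\<close> merge into one by multiplication, which is why each disjunct needs
  only a single \<open>q\<close>.
\<close>

lemma constructible_normal_form:
  assumes "constructible V \<phi>"
  shows "\<exists>L. (\<forall>(ps, q) \<in> set L. (\<forall>p\<in>set ps. poly_fun V p) \<and> poly_fun V q) \<and>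
    (\<forall>x. \<phi> x \<longleftrightarrow> (\<exists>(ps, q) \<in> set L. (\<forall>p\<in>set ps. p x = 0) \<and> q x \<noteq> 0))"
  using assms
proof induction
  case (eq f)
  then show ?case
    by (intro exI[of _ "[([f], \<lambda>x. 1)]"]) (auto intro: poly_fun.const)
next
  case (neq f)
  then show ?case
    by (intro exI[of _ "[([], f)]"]) auto
next
  case (conj \<phi> \<psi>)
  from conj.IH(1) obtain L where
    L: "\<forall>(ps, q) \<in> set L. (\<forall>p\<in>set ps. poly_fun V p) \<and> poly_fun V q"
       "\<forall>x. \<phi> x \<longleftrightarrow> (\<exists>(ps, q) \<in> set L. (\<forall>p\<in>set ps. p x = 0) \<and> q x \<noteq> 0)"
    by (elim exE conjE) (rule that)
  from conj.IH(2) obtain M where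
    M: "\<forall>(ps, q) \<in> set M. (\<forall>p\<in>set ps. poly_fun V p) \<and> poly_fun V q"
       "\<forall>x. \<psi> x \<longleftrightarrow> (\<exists>(ps, q) \<in> set M. (\<forall>p\<in>set ps. p x = 0) \<and> q x \<noteq> 0)"
    by (elim exE conjE) (rule that)
  define N where "N = map (\<lambda>((ps, q), (ps', q')). (ps @ ps', \<lambda>x. q x * q' x)) (List.product L M)"
  have "\<forall>(ps, q) \<in> set N. (\<forall>p\<in>set ps. poly_fun V p) \<and> poly_fun V q"
    using L(1) M(1) by (fastforce simp: N_def intro: poly_fun.mult)
  moreover have "(\<phi> x \<and> \<psi> x) \<longleftrightarrow> (\<exists>(ps, q) \<in> set N. (\<forall>p\<in>set ps. p x = 0) \<and> q x \<noteq> 0)" for x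
  proof -
    have "(\<exists>(ps, q) \<in> set N. (\<forall>p\<in>set ps. p x = 0) \<and> q x \<noteq> 0) \<longleftrightarrow>
      (\<exists>a\<in>set L. \<exists>b\<in>set M. (\<forall>p\<in>set (fst a). p x = 0) \<and> (\<forall>p\<in>set (fst b). p x = 0) \<and>
        snd a x \<noteq> 0 \<and> snd b x \<noteq> 0)"
      unfolding N_def set_map set_product bex_simps(7) bex_Times
      by (simp add: case_prod_unfold ball_Un conj_ac)
    thus ?thesis
      unfolding L(2)[rule_format] M(2)[rule_format] by (simp add: case_prod_unfold) blast
  qed
  ultimately show ?case by blast
next
  case (disj \<phi> \<psi>)
  from disj.IH(1) obtain L where
    L: "\<forall>(ps, q) \<in> set L. (\<forall>p\<in>set ps. poly_fun V p) \<and> poly_fun V q"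
       "\<forall>x. \<phi> x \<longleftrightarrow> (\<exists>(ps, q) \<in> set L. (\<forall>p\<in>set ps. p x = 0) \<and> q x \<noteq> 0)"
    by (elim exE conjE) (rule that)
  from disj.IH(2) obtain M where
    M: "\<forall>(ps, q) \<in> set M. (\<forall>p\<in>set ps. poly_fun V p) \<and> poly_fun V q"
       "\<forall>x. \<psi> x \<longleftrightarrow> (\<exists>(ps, q) \<in> set M. (\<forall>p\<in>set ps. p x = 0) \<and> q x \<noteq> 0)"
    by (elim exE conjE) (rule that)
  show ?case
    by (rule exI[of _ "L @ M"]) (use L M in auto)
qed

section \<open>Elimination of one variable\<close>

text \<open>
  A polynomial in one distinguished variable whose coefficients are polynomial functions of the
  other ones. The bound \<open>d\<close> on the number of coefficients is uniform in the parameters and is what the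
  elimination decreases; the true degree varies with the parameters.
\<close>

definition param_poly :: "'v set \<Rightarrow> nat \<Rightarrow> (('v \<Rightarrow> complex) \<Rightarrow> complex poly) \<Rightarrow> bool" where
  "param_poly V d F \<longleftrightarrow>
     (\<forall>i. poly_fun V (\<lambda>x. coeff (F x) i)) \<and> (\<forall>x. \<forall>i\<ge>d. coeff (F x) i = 0)"

lemma param_poly_coeff: "param_poly V d F \<Longrightarrow> poly_fun V (\<lambda>x. coeff (F x) i)"
  by (simp add: param_poly_def)

lemma param_poly_zero: "param_poly V 0 F \<Longrightarrow> F x = 0"
  by (simp add: param_poly_def poly_eq_iff)

lemma param_poly_mono: "param_poly V d F \<Longrightarrow> d \<le> e \<Longrightarrow> param_poly V e F"
  by (simp add: param_poly_def)

lemma param_poly_add: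
  "param_poly V d F \<Longrightarrow> param_poly V e G \<Longrightarrow> param_poly V (max d e) (\<lambda>x. F x + G x)"
  by (auto simp: param_poly_def intro: poly_fun.add)

lemma param_poly_mult:
  assumes "param_poly V d F" "param_poly V e G"
  shows "param_poly V (d + e) (\<lambda>x. F x * G x)"
  unfolding param_poly_def
proof (intro conjI allI impI)
  fix i show "poly_fun V (\<lambda>x. coeff (F x * G x) i)"
    unfolding coeff_mult using assms
    by (intro poly_fun_sum poly_fun.mult) (auto simp: param_poly_def)
next
  fix x i assume "d + e \<le> i"
  hence "coeff (F x) k * coeff (G x) (i - k) = 0" if "k \<le> i" for k
    using assms that unfolding param_poly_def by (cases "d \<le> k") auto
  thus "coeff (F x * G x) i = 0" unfolding coeff_mult by (intro sum.neutral) auto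
qed

lemma param_poly_const: "poly_fun V f \<Longrightarrow> param_poly V (Suc 0) (\<lambda>x. [:f x:])"
  unfolding param_poly_def
proof (intro conjI allI impI)
  fix i assume "poly_fun V f"
  thus "poly_fun V (\<lambda>x. coeff [:f x:] i)" by (cases i) (auto intro: poly_fun.const)
qed (auto simp: coeff_pCons split: nat.split)

lemma poly_fun_as_param_poly:
  assumes "poly_fun V f"
  shows "\<exists>d F. param_poly (V - {v}) d F \<and> (\<forall>x t. f (x(v := t)) = poly (F x) t)"
  using assms
proof induction
  case (var u)
  show ?case
  proof (cases "u = v")
    case True
    thus ?thesis
      by (intro exI[of _ 2] exI[of _ "\<lambda>x. [:0, 1:]"])
        (auto simp: param_poly_def intro: poly_fun.const split: nat.splits simp: coeff_pCons)
  next
    case False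
    thus ?thesis using var
      by (intro exI[of _ "Suc 0"] exI[of _ "\<lambda>x. [:x u:]"])
        (auto intro!: param_poly_const poly_fun.var)
  qed
next
  case (const c)
  show ?case
    by (intro exI[of _ "Suc 0"] exI[of _ "\<lambda>x. [:c:]"])
      (auto intro!: param_poly_const poly_fun.const)
next
  case (add f g)
  from add.IH(1) obtain d F where F: "param_poly (V - {v}) d F" "\<And>x t. f (x(v := t)) = poly (F x) t"
    by blast
  from add.IH(2) obtain e G where G: "param_poly (V - {v}) e G" "\<And>x t. g (x(v := t)) = poly (G x) t"
    by blast
  show ?case
    by (rule exI[of _ "max d e"], rule exI[of _ "\<lambda>x. F x + G x"])
      (use F G param_poly_add[OF F(1) G(1)] in \<open>simp add: fun_upd_def\<close>)
next
  case (mult f g)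
  from mult.IH(1) obtain d F where F: "param_poly (V - {v}) d F" "\<And>x t. f (x(v := t)) = poly (F x) t"
    by blast
  from mult.IH(2) obtain e G where G: "param_poly (V - {v}) e G" "\<And>x t. g (x(v := t)) = poly (G x) t"
    by blast
  show ?case
    by (rule exI[of _ "d + e"], rule exI[of _ "\<lambda>x. F x * G x"])
      (use F G param_poly_mult[OF F(1) G(1)] in \<open>simp add: fun_upd_def\<close>)
qed

text \<open>
  One step of pseudo-division of \<open>q\<close> by \<open>p\<close>: it multiplies by the leading coefficient instead of
  dividing by it, so that coefficients stay polynomial in the parameters.
\<close>

definition cancel_lead :: "nat \<Rightarrow> nat \<Rightarrow> complex poly \<Rightarrow> complex poly \<Rightarrow> complex poly" where
  "cancel_lead d e p q = smult (coeff p d) q - monom (coeff q e) (e - d) * p"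

lemma param_poly_cancel_lead:
  assumes F: "param_poly V (Suc d) F" and G: "param_poly V (Suc e) G" and "d \<le> e"
  shows "param_poly V e (\<lambda>x. cancel_lead d e (F x) (G x))"
  unfolding param_poly_def
proof (intro conjI allI impI)
  fix i show "poly_fun V (\<lambda>x. coeff (cancel_lead d e (F x) (G x)) i)"
    using param_poly_coeff[OF F] param_poly_coeff[OF G]
    by (cases "i < e - d")
      (auto simp: cancel_lead_def coeff_monom_mult intro!: poly_fun.intros poly_fun_minus)
next
  fix x i assume "e \<le> i"
  thus "coeff (cancel_lead d e (F x) (G x)) i = 0"
    using F G \<open>d \<le> e\<close>
    by (cases "i = e") (auto simp: cancel_lead_def coeff_monom_mult param_poly_def)
qed

lemma param_poly_pseudo_remainder:
  assumes F: "param_poly V (Suc d) F" and G: "param_poly V e G"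
  shows "\<exists>k R. param_poly V d R \<and> (\<forall>x. \<exists>u. smult (coeff (F x) d ^ k) (G x) = u * F x + R x)"
  using G
proof (induction e arbitrary: G)
  case 0
  show ?case
    by (rule exI[of _ 0], rule exI[of _ G])
      (use 0 in \<open>auto intro: param_poly_mono intro!: exI[of _ 0]\<close>)
next
  case (Suc e)
  show ?case
  proof (cases "d \<le> e")
    case False
    show ?thesis
      by (rule exI[of _ 0], rule exI[of _ G])
        (use Suc.prems False in \<open>auto intro: param_poly_mono intro!: exI[of _ 0]\<close>)
  next
    case True
    from Suc.IH[OF param_poly_cancel_lead[OF F Suc.prems True]] obtain k R where
      R: "param_poly V d R"
      "\<And>x. \<exists>u. smult (coeff (F x) d ^ k) (cancel_lead d e (F x) (G x)) = u * F x + R x" by blast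
    have "\<exists>u. smult (coeff (F x) d ^ Suc k) (G x) = u * F x + R x" for x
    proof -
      from R(2)[of x] obtain u where
        u: "smult (coeff (F x) d ^ k) (cancel_lead d e (F x) (G x)) = u * F x + R x" ..
      have "smult (coeff (F x) d ^ Suc k) (G x) =
        (u + smult (coeff (F x) d ^ k) (monom (coeff (G x) e) (e - d))) * F x + R x"
        using u by (simp add: cancel_lead_def algebra_simps smult_diff_right mult_smult_left)
      thus ?thesis ..
    qed
    thus ?thesis using R(1) by blast
  qed
qed

lemma constructible_param_poly_nonzero:
  assumes "param_poly V d F"
  shows "constructible V (\<lambda>x. F x \<noteq> 0)"
proof -
  have "(\<lambda>x. F x \<noteq> 0) = (\<lambda>x. \<exists>i\<in>{..<d}. coeff (F x) i \<noteq> 0)"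
  proof
    fix x show "(F x \<noteq> 0) = (\<exists>i\<in>{..<d}. coeff (F x) i \<noteq> 0)"
      using assms unfolding param_poly_def poly_eq_iff
      by (metis coeff_0 lessThan_iff not_le)
  qed
  thus ?thesis
    using constructible_Bex[of "{..<d}" V "\<lambda>i x. coeff (F x) i \<noteq> 0"]
      constructible.neq[OF param_poly_coeff[OF assms]] by simp
qed

text \<open>
  If every root of \<open>p\<close> is a root of \<open>q\<close>, then the multiplicities, being at most \<open>d\<close>, are absorbed by \<open>q ^ d\<close>.
\<close>

lemma poly_root_nonroot_iff_not_dvd:
  fixes p q :: "complex poly"
  assumes "coeff p d \<noteq> 0" "degree p = d"
  shows "(\<exists>t. poly p t = 0 \<and> poly q t \<noteq> 0) \<longleftrightarrow> \<not> p dvd q ^ d"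
proof -
  have "p \<noteq> 0" using assms(1) by auto
  thus ?thesis using nullstellensatz_univariate[of p q] assms(2) by blast
qed

text \<open>
  Where the top coefficient of \<open>F\<close> does not vanish, solvability of \<open>F = 0 \<noteq> Q\<close> means that \<open>F\<close>
  does not divide \<open>Q ^ d\<close>, that is, that the pseudo-remainder of \<open>Q ^ d\<close> is nonzero.
\<close>

lemma constructible_root_of_full_degree:
  assumes F: "param_poly V (Suc d) F" and Q: "param_poly V e Q"
  shows "constructible V (\<lambda>x. coeff (F x) d \<noteq> 0 \<and> (\<exists>t. poly (F x) t = 0 \<and> poly (Q x) t \<noteq> 0))"
proof -
  have "\<exists>e'. param_poly V e' (\<lambda>x. Q x ^ k)" for k
  proof (induction k)
    case 0
    show ?case
      by (intro exI[of _ 1]) (auto simp: param_poly_def intro: poly_fun.const)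
  next
    case (Suc k)
    then obtain e' where "param_poly V e' (\<lambda>x. Q x ^ k)" ..
    from param_poly_mult[OF Q this] show ?case by auto
  qed
  then obtain e' where "param_poly V e' (\<lambda>x. Q x ^ d)" by blast
  from param_poly_pseudo_remainder[OF F this] obtain k R where R: "param_poly V d R"
    "\<And>x. \<exists>u. smult (coeff (F x) d ^ k) (Q x ^ d) = u * F x + R x" by blast
  have "(\<exists>t. poly (F x) t = 0 \<and> poly (Q x) t \<noteq> 0) \<longleftrightarrow> R x \<noteq> 0" if a: "coeff (F x) d \<noteq> 0" for x
  proof -
    have deg: "degree (F x) = d"
      using F a by (intro antisym degree_le le_degree) (auto simp: param_poly_def)
    from R(2)[of x] obtain u where u: "smult (coeff (F x) d ^ k) (Q x ^ d) = u * F x + R x" ..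
    have "F x dvd Q x ^ d \<longleftrightarrow> F x dvd smult (coeff (F x) d ^ k) (Q x ^ d)"
      using a by (simp add: dvd_smult_iff)
    also have "\<dots> \<longleftrightarrow> F x dvd R x" unfolding u by (simp add: dvd_add_right_iff)
    also have "\<dots> \<longleftrightarrow> R x = 0"
    proof
      assume dvd: "F x dvd R x"
      show "R x = 0"
      proof (rule ccontr)
        assume "R x \<noteq> 0"
        hence "d \<le> degree (R x)" using dvd_imp_degree_le[OF dvd] deg by simp
        hence "lead_coeff (R x) = 0" using R(1) by (auto simp: param_poly_def)
        thus False using \<open>R x \<noteq> 0\<close> by simp
      qed
    qed simp
    finally show ?thesis using poly_root_nonroot_iff_not_dvd[OF a deg] by simp
  qed
  hence "(\<lambda>x. coeff (F x) d \<noteq> 0 \<and> (\<exists>t. poly (F x) t = 0 \<and> poly (Q x) t \<noteq> 0)) =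
    (\<lambda>x. coeff (F x) d \<noteq> 0 \<and> R x \<noteq> 0)"
    by (intro ext) (rule conj_cong[OF refl])
  thus ?thesis
    using constructible.conj[OF constructible.neq[OF param_poly_coeff[OF F, of d]]
        constructible_param_poly_nonzero[OF R(1)]] by simp
qed

lemma param_poly_truncate:
  assumes "param_poly V (Suc d) F"
  shows "param_poly V d (\<lambda>x. F x - monom (coeff (F x) d) d)"
  unfolding param_poly_def
proof (intro conjI allI impI)
  fix i show "poly_fun V (\<lambda>x. coeff (F x - monom (coeff (F x) d) d) i)"
    using param_poly_coeff[OF assms]
    by (cases "i = d") (auto intro: poly_fun.const)
next
  fix x i assume "d \<le> i"
  thus "coeff (F x - monom (coeff (F x) d) d) i = 0"
    using assms by (cases "i = d") (auto simp: param_poly_def)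
qed

text \<open>
  Euclid's algorithm with case distinctions. Given two equations, take the one with the smaller
  degree bound: either its top coefficient vanishes and it gets shorter, or it can be used to
  shorten the other one.
  A single equation is dealt with by \<open>constructible_root_of_full_degree\<close>, and with no equation left
  the question is whether \<open>Q\<close> is the zero polynomial.
\<close>

lemma constructible_common_root:
  assumes "\<forall>(d, F) \<in> set Fs. param_poly V d F" and Q: "param_poly V e Q"
  shows "constructible V (\<lambda>x. \<exists>t. (\<forall>(d, F) \<in> set Fs. poly (F x) t = 0) \<and> poly (Q x) t \<noteq> 0)"
  using assms(1)
proof (induction "length Fs + sum_list (map fst Fs)" arbitrary: Fs rule: less_induct)
  case less
  note IH = less.hyps and Fs = less.prems
  let ?\<Phi> = "\<lambda>Fs x. \<exists>t. (\<forall>(d, F) \<in> set Fs. poly (F x) t = 0) \<and> poly (Q x) t \<noteq> 0"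
  consider "Fs = []" | F d Gs where "Fs = (d, F) # Gs" "d = 0 \<or> Gs = []"
    | F d G e' Gs where "Fs = (d, F) # (e', G) # Gs" "d > 0"
    by (cases Fs; cases "tl Fs") force+
  thus ?case
  proof cases
    case 1
    have "(\<lambda>x. ?\<Phi> Fs x) = (\<lambda>x. Q x \<noteq> 0)"
      unfolding 1 by (auto simp: fun_eq_iff simp flip: poly_all_0_iff_0)
    thus ?thesis using constructible_param_poly_nonzero[OF Q] by simp
  next
    case (2 F d Gs)
    have F: "param_poly V d F" using Fs 2 by auto
    show ?thesis
    proof (cases d)
      case 0
      have "?\<Phi> Fs = ?\<Phi> Gs"
        using param_poly_zero[OF F[unfolded 0]] 2(1) by auto
      moreover have "constructible V (?\<Phi> Gs)"
        by (rule IH) (use 2(1) Fs in auto)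
      ultimately show ?thesis by simp
    next
      case (Suc d')
      let ?F = "\<lambda>x. F x - monom (coeff (F x) d') d'"
      have Gs: "Gs = []" using 2 Suc by simp
      have F': "param_poly V (Suc d') F" using F Suc by simp
      have "constructible V (?\<Phi> [(d', ?F)])"
        by (rule IH) (use 2(1) Suc Gs param_poly_truncate[OF F'] in auto)
      from constructible.disj[OF constructible.conj[OF constructible.eq[OF param_poly_coeff[OF F, of d']] this]
          constructible_root_of_full_degree[OF F' Q]]
      show ?thesis
        by (rule back_subst[of "constructible V"]) (auto simp: 2(1) Gs fun_eq_iff)
    qed
  next
    case (3 F d G e' Gs)
    have step: "constructible V (?\<Phi> ((Suc d, F) # (Suc e, G) # Gs))"
      if F: "param_poly V (Suc d) F" and G: "param_poly V (Suc e) G"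
        and Gs: "\<forall>(d, F) \<in> set Gs. param_poly V d F" and de: "d \<le> e"
        and size: "length Fs + sum_list (map fst Fs) =
          length ((Suc d, F) # (Suc e, G) # Gs) + sum_list (map fst ((Suc d, F) # (Suc e, G) # Gs))"
      for d e F G
    proof -
      let ?F = "\<lambda>x. F x - monom (coeff (F x) d) d" and ?G = "\<lambda>x. cancel_lead d e (F x) (G x)"
      have 1: "constructible V (?\<Phi> ((d, ?F) # (Suc e, G) # Gs))"
        by (rule IH) (use size param_poly_truncate[OF F] G Gs in auto)
      have 2: "constructible V (?\<Phi> ((Suc d, F) # (e, ?G) # Gs))"
        by (rule IH) (use size param_poly_cancel_lead[OF F G de] F Gs in auto)
      have red: "poly (cancel_lead d e (F x) (G x)) t = 0 \<longleftrightarrow> poly (G x) t = 0"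
        if "poly (F x) t = 0" "coeff (F x) d \<noteq> 0" for x t
        using that by (simp add: cancel_lead_def)
      have "?\<Phi> ((Suc d, F) # (Suc e, G) # Gs) x \<longleftrightarrow>
          coeff (F x) d = 0 \<and> ?\<Phi> ((d, ?F) # (Suc e, G) # Gs) x \<or>
          coeff (F x) d \<noteq> 0 \<and> ?\<Phi> ((Suc d, F) # (e, ?G) # Gs) x" for x
        by (cases "coeff (F x) d = 0") (simp_all add: red cong: conj_cong)
      thus ?thesis
        using constructible.disj[OF
            constructible.conj[OF constructible.eq[OF param_poly_coeff[OF F, of d]] 1]
            constructible.conj[OF constructible.neq[OF param_poly_coeff[OF F, of d]] 2]]
        by presburger
    qed
    have F: "param_poly V d F" and G: "param_poly V e' G"
      and Gs: "\<forall>(d, F) \<in> set Gs. param_poly V d F" using Fs 3 by auto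
    show ?thesis
    proof (cases e')
      case 0
      have "?\<Phi> Fs = ?\<Phi> ((d, F) # Gs)"
        using param_poly_zero[OF G[unfolded 0]] 3(1) by auto
      moreover have "constructible V (?\<Phi> ((d, F) # Gs))"
        by (rule IH) (use 3(1) Fs in auto)
      ultimately show ?thesis by simp
    next
      case (Suc e'')
      obtain d' where d: "d = Suc d'" using \<open>d > 0\<close> by (cases d) auto
      show ?thesis
      proof (cases "d' \<le> e''")
        case True
        show ?thesis using step[of d' F e'' G] F G Gs True unfolding 3(1) d Suc by simp
      next
        case False
        have "constructible V (?\<Phi> ((Suc e'', G) # (Suc d', F) # Gs))"
          using step[of e'' G d' F] F G Gs False unfolding 3(1) d Suc by simp
        thus ?thesis
          by (rule back_subst[of "constructible V"]) (auto simp: 3(1) d Suc)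
      qed
    qed
  qed
qed

text \<open>
  Projections of constructible sets are constructible (Chevalley, Tarski).
\<close>

theorem constructible_ex:
  assumes "constructible V \<phi>"
  shows "constructible (V - {v}) (\<lambda>x. \<exists>t. \<phi> (x(v := t)))"
proof -
  obtain L where L: "\<forall>(ps, q) \<in> set L. (\<forall>p\<in>set ps. poly_fun V p) \<and> poly_fun V q"
    "\<And>x. \<phi> x \<longleftrightarrow> (\<exists>(ps, q) \<in> set L. (\<forall>p\<in>set ps. p x = 0) \<and> q x \<noteq> 0)"
    using constructible_normal_form[OF assms] by blast
  let ?R = "\<lambda>p dF. param_poly (V - {v}) (fst dF) (snd dF) \<and> (\<forall>x t. p (x(v := t)) = poly (snd dF x) t)"
  have "constructible (V - {v}) (\<lambda>x. \<exists>t. (\<forall>p\<in>set ps. p (x(v := t)) = 0) \<and> q (x(v := t)) \<noteq> 0)"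
    if "(ps, q) \<in> set L" for ps q
  proof -
    have ps: "\<forall>p\<in>set ps. \<exists>dF. ?R p dF" and "\<exists>dF. ?R q dF"
      using L(1) that poly_fun_as_param_poly[of V _ v] by fastforce+
    then obtain h e Q where h: "\<forall>p\<in>set ps. ?R p (h p)" and Q: "?R q (e, Q)"
      by (metis prod.exhaust)
    from constructible_common_root[of "map h ps" "V - {v}" e Q] h Q
    show ?thesis by (simp add: case_prod_unfold)
  qed
  hence "constructible (V - {v}) (\<lambda>x. \<exists>b\<in>set L. \<exists>t. (\<forall>p\<in>set (fst b). p (x(v := t)) = 0) \<and> snd b (x(v := t)) \<noteq> 0)"
    by (intro constructible_Bex) auto
  thus ?thesis
    by (rule back_subst[of "constructible (V - {v})"]) (auto simp: L(2) fun_eq_iff case_prod_unfold)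
qed

corollary constructible_ex_finite:
  assumes "finite P" "constructible V \<phi>"
  shows "constructible (V - P) (\<lambda>x. \<exists>y. \<phi> (\<lambda>v. if v \<in> P then y v else x v))"
  using assms(1)
proof induction
  case empty
  then show ?case using assms(2) by simp
next
  case (insert u P)
  have "(\<exists>t y. \<phi> (\<lambda>v. if v \<in> P then y v else (x(u := t)) v)) \<longleftrightarrow>
    (\<exists>y. \<phi> (\<lambda>v. if v \<in> insert u P then y v else x v))" (is "?l \<longleftrightarrow> ?r") for x
  proof
    assume ?l
    then obtain t y where "\<phi> (\<lambda>v. if v \<in> P then y v else (x(u := t)) v)" by blast
    moreover have "(\<lambda>v. if v \<in> P then y v else (x(u := t)) v) =
      (\<lambda>v. if v \<in> insert u P then (y(u := t)) v else x v)"
      using insert.hyps by auto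
    ultimately show ?r by (intro exI[of _ "y(u := t)"]) simp
  next
    assume ?r
    then obtain y where "\<phi> (\<lambda>v. if v \<in> insert u P then y v else x v)" by blast
    moreover have "(\<lambda>v. if v \<in> P then y v else (x(u := y u)) v) =
      (\<lambda>v. if v \<in> insert u P then y v else x v)" by auto
    ultimately show ?l by (intro exI[of _ "y u"] exI[of _ y]) simp
  qed
  moreover have "V - insert u P = V - P - {u}" by auto
  ultimately show ?case using constructible_ex[OF insert.IH, of u] by simp
qed

section \<open>Polynomials vanishing along curves\<close>

text \<open>
  Here \<open>c k\<close> is the homogeneous part of degree \<open>k\<close> of the Taylor expansion of \<open>f\<close> at \<open>y\<close>.
\<close>

lemma poly_fun_homogeneous_expansion:
  assumes "poly_fun V f"
  shows "\<exists>d c. (\<forall>k. poly_fun V (c k)) \<and> (\<forall>s z. f (\<lambda>v. y v + s * z v) = (\<Sum>k\<le>d. s ^ k * c k z))"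
  using assms
proof induction
  case (var v)
  let ?c = "\<lambda>k z. if k = 0 then y v else if k = 1 then z v else (0 :: complex)"
  show ?case
  proof (rule exI[of _ 1], rule exI[of _ ?c], intro conjI allI)
    fix k show "poly_fun V (?c k)"
      using var by (cases "k = 0"; cases "k = 1") (auto intro: poly_fun.intros)
  qed simp
next
  case (const a)
  let ?c = "\<lambda>k z. if k = 0 then a else (0 :: complex)"
  show ?case
  proof (rule exI[of _ 0], rule exI[of _ ?c], intro conjI allI)
    fix k show "poly_fun V (?c k)"
      by (cases "k = 0") (auto intro: poly_fun.intros)
  qed simp
next
  case (add f g)
  from add.IH(1) obtain d c where c: "\<And>k. poly_fun V (c k)"
    "\<And>s z. f (\<lambda>v. y v + s * z v) = (\<Sum>k\<le>d. s ^ k * c k z)" by blast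
  from add.IH(2) obtain e b where b: "\<And>k. poly_fun V (b k)"
    "\<And>s z. g (\<lambda>v. y v + s * z v) = (\<Sum>k\<le>e. s ^ k * b k z)" by blast
  let ?c = "\<lambda>k z. (if k \<le> d then c k z else 0) + (if k \<le> e then b k z else 0)"
  show ?case
  proof (rule exI[of _ "d + e"], rule exI[of _ ?c], intro conjI allI)
    fix k show "poly_fun V (?c k)" 
      using c(1) b(1) by (intro poly_fun.add; cases "k \<le> d"; cases "k \<le> e") (auto intro: poly_fun.const)
  next
    fix s z
    have "(\<Sum>k\<le>d. s ^ k * c k z) = (\<Sum>k\<le>d+e. s ^ k * (if k \<le> d then c k z else 0))"
      by (rule sum.mono_neutral_cong_left) auto
    moreover have "(\<Sum>k\<le>e. s ^ k * b k z) = (\<Sum>k\<le>d+e. s ^ k * (if k \<le> e then b k z else 0))"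
      by (rule sum.mono_neutral_cong_left) auto
    ultimately show "f (\<lambda>v. y v + s * z v) + g (\<lambda>v. y v + s * z v) = (\<Sum>k\<le>d+e. s ^ k * ?c k z)"
      unfolding c(2) b(2) distrib_left sum.distrib by simp
  qed
next
  case (mult f g)
  from mult.IH(1) obtain d c where c: "\<And>k. poly_fun V (c k)"
    "\<And>s z. f (\<lambda>v. y v + s * z v) = (\<Sum>k\<le>d. s ^ k * c k z)" by blast
  from mult.IH(2) obtain e b where b: "\<And>k. poly_fun V (b k)"
    "\<And>s z. g (\<lambda>v. y v + s * z v) = (\<Sum>k\<le>e. s ^ k * b k z)" by blast
  let ?c = "\<lambda>k z. \<Sum>i\<le>d. \<Sum>j\<le>e. (if i + j = k then 1 else 0) * (c i z * b j z)"
  show ?case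
  proof (rule exI[of _ "d + e"], rule exI[of _ ?c], intro conjI allI)
    fix k show "poly_fun V (?c k)"
      using c(1) b(1) by (intro poly_fun_sum poly_fun.mult poly_fun.const) auto
  next
    fix s z
    have "f (\<lambda>v. y v + s * z v) * g (\<lambda>v. y v + s * z v) =
        (\<Sum>i\<le>d. \<Sum>j\<le>e. s ^ (i + j) * (c i z * b j z))"
      unfolding c(2) b(2) sum_product by (simp add: power_add algebra_simps)
    also have "\<dots> = (\<Sum>i\<le>d. \<Sum>j\<le>e. \<Sum>k\<le>d+e. (if k = i + j then s ^ k * (c i z * b j z) else 0))"
      by (intro sum.cong refl) (simp add: sum.delta)
    also have "\<dots> = (\<Sum>i\<le>d. \<Sum>k\<le>d+e. \<Sum>j\<le>e. (if k = i + j then s ^ k * (c i z * b j z) else 0))"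
      by (intro sum.cong refl sum.swap)
    also have "\<dots> = (\<Sum>k\<le>d+e. \<Sum>i\<le>d. \<Sum>j\<le>e. (if k = i + j then s ^ k * (c i z * b j z) else 0))"
      by (rule sum.swap)
    also have "\<dots> = (\<Sum>k\<le>d+e. s ^ k * ?c k z)"
      unfolding sum_distrib_left by (intro sum.cong refl) auto
    finally show "f (\<lambda>v. y v + s * z v) * g (\<lambda>v. y v + s * z v) = (\<Sum>k\<le>d+e. s ^ k * ?c k z)" .
  qed
qed

lemma poly_fun_tendsto:
  assumes "poly_fun V f" "\<And>v. v \<in> V \<Longrightarrow> ((\<lambda>s. w s v) \<longlongrightarrow> z v) F"
  shows "((\<lambda>s. f (w s)) \<longlongrightarrow> f z) F"
  using assms by induction (auto intro: tendsto_const tendsto_add tendsto_mult)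

text \<open>
  Let \<open>c k\<close> be the lowest homogeneous part at \<open>y\<close> that has not yet been shown to vanish. Along a
  curve with velocity \<open>z\<close> the value of \<open>f\<close> is \<open>s ^ k * c k z\<close> up to higher order in \<open>s\<close>, hence
  \<open>c k z = 0\<close>.
\<close>

lemma poly_fun_zero_if_vanishes_along_curves:
  assumes f: "poly_fun V f"
    and curve: "\<And>z. \<exists>\<gamma>. (\<forall>s. f (\<gamma> s) = 0) \<and>
      (\<forall>v\<in>V. \<gamma> 0 v = y v \<and> ((\<lambda>s. \<gamma> s v) has_field_derivative z v) (at 0))"
  shows "f x = 0"
proof -
  obtain d c where c: "\<And>k. poly_fun V (c k)"
    "\<And>s z. f (\<lambda>v. y v + s * z v) = (\<Sum>k\<le>d. s ^ k * c k z)"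
    using poly_fun_homogeneous_expansion[OF f, of y] by blast
  have "c k z = 0" if "k \<le> d" for k z
    using that
  proof (induction k arbitrary: z rule: less_induct)
    case (less k)
    obtain \<gamma> where \<gamma>: "\<And>s. f (\<gamma> s) = 0" "\<And>v. v \<in> V \<Longrightarrow> \<gamma> 0 v = y v"
      "\<And>v. v \<in> V \<Longrightarrow> ((\<lambda>s. \<gamma> s v) has_field_derivative z v) (at 0)"
      using curve[of z] by blast
    \<comment> \<open>The secant direction, which tends to the velocity \<open>z\<close>.\<close>
    define w where "w s v = (\<gamma> s v - y v) / s" for s v
    have "((\<lambda>s. w s v) \<longlongrightarrow> z v) (at 0)" if "v \<in> V" for v
      using \<gamma>(2,3)[OF that] by (simp add: w_def has_field_derivative_iff)
    hence lim: "((\<lambda>s. c j (w s)) \<longlongrightarrow> c j z) (at 0)" for j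
      by (intro poly_fun_tendsto[OF c(1)])
    have "((\<lambda>s. \<Sum>j\<in>{k..d}. s ^ (j - k) * c j (w s)) \<longlongrightarrow> (\<Sum>j\<in>{k..d}. 0 ^ (j - k) * c j z)) (at 0)"
      by (intro tendsto_intros lim)
    also have "(\<Sum>j\<in>{k..d}. 0 ^ (j - k) * c j z) = (\<Sum>j\<in>{k..d}. if j = k then c j z else 0)"
      by (intro sum.cong refl) auto
    also have "\<dots> = c k z" using less.prems by simp
    finally have 1: "((\<lambda>s. \<Sum>j\<in>{k..d}. s ^ (j - k) * c j (w s)) \<longlongrightarrow> c k z) (at 0)" .
    have "(\<Sum>j\<in>{k..d}. s ^ (j - k) * c j (w s)) = 0" if "s \<noteq> 0" for s
    proof -
      have "(\<lambda>v. y v + s * w s v) = \<gamma> s" using that by (auto simp: w_def)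
      hence "0 = (\<Sum>j\<le>d. s ^ j * c j (w s))" using c(2)[of s "w s"] \<gamma>(1)[of s] by simp
      also have "\<dots> = (\<Sum>j\<in>{k..d}. s ^ j * c j (w s))"
        using less.IH by (intro sum.mono_neutral_right) auto
      also have "\<dots> = s ^ k * (\<Sum>j\<in>{k..d}. s ^ (j - k) * c j (w s))"
        unfolding sum_distrib_left
        by (intro sum.cong refl) (simp flip: power_add mult.assoc)
      finally show ?thesis using that by simp
    qed
    hence "((\<lambda>s. \<Sum>j\<in>{k..d}. s ^ (j - k) * c j (w s)) \<longlongrightarrow> 0) (at 0)"
      by (intro tendsto_eventually) (auto simp: eventually_at_filter)
    thus ?case using tendsto_unique[OF _ 1] by simp
  qed
  hence "f (\<lambda>v. y v + 1 * (x v - y v)) = 0" unfolding c(2) by simp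
  thus ?thesis by simp
qed

section \<open>Toeplitz and Hankel products\<close>

lemma mat_mult_entry:
  assumes "A \<in> carrier_mat n n" "B \<in> carrier_mat n n" "i < n" "j < n"
  shows "(A * B) $$ (i, j) = (\<Sum>l<n. A $$ (i, l) * B $$ (l, j))"
  using assms by (simp add: scalar_prod_def atLeast0LessThan)

definition toeplitz_mat :: "nat \<Rightarrow> complex mat \<Rightarrow> bool" where
  "toeplitz_mat n T \<longleftrightarrow> T \<in> carrier_mat n n \<and>
     (\<forall>i < n. \<forall>j < n. \<forall>i' < n. \<forall>j' < n. i + j' = i' + j \<longrightarrow> T $$ (i, j) = T $$ (i', j'))"

lemma toeplitz_matD:
  "toeplitz_mat n T \<Longrightarrow> i < n \<Longrightarrow> j < n \<Longrightarrow> i' < n \<Longrightarrow> j' < n \<Longrightarrow> i + j' = i' + j \<Longrightarrow>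
    T $$ (i, j) = T $$ (i', j')"
  unfolding toeplitz_mat_def by blast

lemma toeplitz_mat_carrier [simp]: "toeplitz_mat n T \<Longrightarrow> T \<in> carrier_mat n n"
  by (simp add: toeplitz_mat_def)

primrec factor_prod :: "nat \<Rightarrow> (nat \<Rightarrow> complex mat) \<Rightarrow> nat \<Rightarrow> complex mat" where
  "factor_prod n T 0 = 1\<^sub>m n"
| "factor_prod n T (Suc r) = factor_prod n T r * T r"

lemma factor_prod_carrier [simp]:
  "(\<And>k. T k \<in> carrier_mat n n) \<Longrightarrow> factor_prod n T r \<in> carrier_mat n n"
  by (induction r) auto

lemma foldr_mult_mat:
  fixes A :: "complex mat"
  assumes "set Hs \<subseteq> carrier_mat n n" "A \<in> carrier_mat n n"
  shows "foldr (*) Hs A = foldr (*) Hs (1\<^sub>m n) * A \<and> foldr (*) Hs A \<in> carrier_mat n n \<and>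
    foldr (*) Hs (1\<^sub>m n) \<in> carrier_mat n n"
  using assms(1)
proof (induction Hs)
  case Nil
  then show ?case using assms(2) left_mult_one_mat[OF assms(2)] by simp
next
  case (Cons H Hs)
  then show ?case using assms(2)
    by (auto simp: assoc_mult_mat[of H n n "foldr (*) Hs (1\<^sub>m n)" n A n])
qed

lemma foldr_eq_factor_prod:
  assumes "\<And>k. T k \<in> carrier_mat n n"
  shows "foldr (*) (map T [0..<r]) (1\<^sub>m n) = factor_prod n T r"
proof (induction r)
  case (Suc r)
  have "foldr (*) (map T [0..<r]) (T r) = foldr (*) (map T [0..<r]) (1\<^sub>m n) * T r"
    using foldr_mult_mat[of "map T [0..<r]" n "T r"] assms by auto
  thus ?case using Suc right_mult_one_mat[OF assms] by simp
qed simp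

text \<open>
  Let \<open>J\<close> be the matrix with ones on the main antidiagonal. As \<open>J * J = 1\<close>, this is \<open>J ^ k\<close>.
\<close>

definition exchange :: "nat \<Rightarrow> nat \<Rightarrow> complex mat" where
  "exchange n k = mat n n (\<lambda>(i, j). if (if even k then i = j else i + j + 1 = n) then 1 else 0)"

lemma exchange_carrier [simp]: "exchange n k \<in> carrier_mat n n"
  by (simp add: exchange_def)

lemma mult_exchange:
  assumes A: "A \<in> carrier_mat n n" and "i < n" "j < n"
  shows "(A * exchange n k) $$ (i, j) = A $$ (i, if even k then j else n - 1 - j)"
    and "(exchange n k * A) $$ (i, j) = A $$ (if even k then i else n - 1 - i, j)"
proof -
  have "(A * exchange n k) $$ (i, j) = (\<Sum>l<n. if l = (if even k then j else n - 1 - j) then A $$ (i, l) else 0)"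
    unfolding mat_mult_entry[OF A exchange_carrier assms(2,3)] using assms
    by (intro sum.cong) (auto simp: exchange_def)
  thus "(A * exchange n k) $$ (i, j) = A $$ (i, if even k then j else n - 1 - j)"
    using assms by simp
  have "(exchange n k * A) $$ (i, j) = (\<Sum>l<n. if l = (if even k then i else n - 1 - i) then A $$ (l, j) else 0)"
    unfolding mat_mult_entry[OF exchange_carrier A assms(2,3)] using assms
    by (intro sum.cong) (auto simp: exchange_def)
  thus "(exchange n k * A) $$ (i, j) = A $$ (if even k then i else n - 1 - i, j)"
    using assms by simp
qed

lemma exchange_mult_self: "exchange n k * exchange n k = 1\<^sub>m n"
  by (rule eq_matI)
    (simp_all add: mult_exchange(1)[OF exchange_carrier] carrier_matD[OF exchange_carrier] del: index_mult_mat(1),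
     auto simp: exchange_def)

text \<open>
  For Toeplitz \<open>T\<close> both \<open>T J\<close> and \<open>J T\<close> are Hankel. Inserting \<open>J J = 1\<close> between the factors turns
  \<open>T\<^sub>0 T\<^sub>1 T\<^sub>2 \<dots> J\<^sup>r\<close> into \<open>(T\<^sub>0 J) (J T\<^sub>1) (T\<^sub>2 J) \<dots>\<close>.
\<close>

lemma toeplitz_product_is_hankel_product:
  assumes T: "\<And>k. toeplitz_mat n (T k)"
  shows "hankel_product n r (factor_prod n T r * exchange n r)"
proof -
  define H where "H k = exchange n k * (T k * exchange n (Suc k))" for k
  have T': "T k \<in> carrier_mat n n" for k using T by simp
  have H: "H k \<in> carrier_mat n n" for k
    unfolding H_def using T' by (intro mult_carrier_mat[of _ n n]) auto
  have "hankel_mat n (H k)" for k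
    unfolding hankel_mat_def
  proof (intro conjI allI impI)
    fix i j i' j' assume *: "i < n" "j < n" "i' < n" "j' < n" "i + j = i' + j'"
    have c: "T k * exchange n (Suc k) \<in> carrier_mat n n"
      using T' by (intro mult_carrier_mat[of _ n n]) auto
    have eq: "H k $$ (a, b) = T k $$ (if even k then a else n - 1 - a, if even k then n - 1 - b else b)"
      if "a < n" "b < n" for a b
      using that by (simp add: H_def mult_exchange[OF c] mult_exchange[OF T'] del: index_mult_mat(1))
    show "H k $$ (i, j) = H k $$ (i', j')"
      unfolding eq[OF *(1,2)] eq[OF *(3,4)] using * by (intro toeplitz_matD[OF T]) auto
  qed (rule H)
  moreover have "factor_prod n H r = factor_prod n T r * exchange n r"
  proof (induction r)
    case 0
    show ?case by (simp add: exchange_def) (auto intro!: eq_matI)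
  next
    case (Suc r)
    note c = T' factor_prod_carrier[of T n, OF T'] exchange_carrier mult_carrier_mat[of _ n n]
    have "factor_prod n H (Suc r) = (factor_prod n T r * exchange n r) * (exchange n r * (T r * exchange n (Suc r)))"
      by (simp add: Suc H_def)
    also have "\<dots> = factor_prod n T r * ((exchange n r * exchange n r) * (T r * exchange n (Suc r)))"
      by (simp add: c assoc_mult_mat[of _ n n _ n _ n])
    also have "\<dots> = factor_prod n T (Suc r) * exchange n (Suc r)"
      by (simp add: c exchange_mult_self assoc_mult_mat[of _ n n _ n _ n] left_mult_one_mat[of _ n n])
    finally show ?case .
  qed
  ultimately show ?thesis
    unfolding hankel_product_def
    by (intro exI[of _ "map H [0..<r]"]) (auto simp: foldr_eq_factor_prod[OF H])
qed

section \<open>The differential of a product\<close>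

text \<open>
  The derivative of the product at \<open>T\<close> in the direction \<open>Y\<close>, given recursively by the Leibniz rule.
\<close>

primrec prod_deriv :: "nat \<Rightarrow> (nat \<Rightarrow> complex mat) \<Rightarrow> (nat \<Rightarrow> complex mat) \<Rightarrow> nat \<Rightarrow> complex mat" where
  "prod_deriv n T Y 0 = 0\<^sub>m n n"
| "prod_deriv n T Y (Suc r) = prod_deriv n T Y r * T r + factor_prod n T r * Y r"

lemma prod_deriv_carrier [simp]:
  "(\<And>k. T k \<in> carrier_mat n n) \<Longrightarrow> (\<And>k. Y k \<in> carrier_mat n n) \<Longrightarrow> prod_deriv n T Y r \<in> carrier_mat n n"
  by (induction r) (simp_all add: mult_carrier_mat[of _ n n _ n])

lemma prod_deriv_Suc_entry:
  assumes "\<And>k. T k \<in> carrier_mat n n" "\<And>k. Y k \<in> carrier_mat n n" "i < n" "j < n"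
  shows "prod_deriv n T Y (Suc r) $$ (i, j) = (\<Sum>l<n. prod_deriv n T Y r $$ (i, l) * T r $$ (l, j)) +
    (\<Sum>l<n. factor_prod n T r $$ (i, l) * Y r $$ (l, j))"
proof -
  have "(factor_prod n T r * Y r) \<in> carrier_mat n n"
    using assms by (intro mult_carrier_mat[of _ n n]) auto
  moreover have c: "prod_deriv n T Y r \<in> carrier_mat n n" "factor_prod n T r \<in> carrier_mat n n"
    using assms by auto
  ultimately have "prod_deriv n T Y (Suc r) $$ (i, j) =
      (prod_deriv n T Y r * T r) $$ (i, j) + (factor_prod n T r * Y r) $$ (i, j)"
    unfolding prod_deriv.simps using assms(3,4) by (subst index_add_mat(1)) auto
  thus ?thesis using c assms by (simp only: mat_mult_entry)
qed

lemma has_field_derivative_factor_prod: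
  assumes T: "\<And>k. T k \<in> carrier_mat n n" and Y: "\<And>k. Y k \<in> carrier_mat n n" and "i < n" "j < n"
  shows "((\<lambda>s. factor_prod n (\<lambda>k. T k + s \<cdot>\<^sub>m Y k) r $$ (i, j)) has_field_derivative
    prod_deriv n T Y r $$ (i, j)) (at 0)"
  using assms(3,4)
proof (induction r arbitrary: i j)
  case 0
  show ?case using 0 by simp
next
  case (Suc r)
  let ?T = "\<lambda>s k. T k + s \<cdot>\<^sub>m Y k"
  have c: "?T s k \<in> carrier_mat n n" for s k using T Y by auto
  have "T k + 0 \<cdot>\<^sub>m Y k = T k" for k
    by (rule eq_matI) (use T[of k] Y[of k] in auto)
  hence T0: "?T 0 = T" by (rule ext)
  have "((\<lambda>s. \<Sum>l<n. factor_prod n (?T s) r $$ (i, l) * (T r $$ (l, j) + s * Y r $$ (l, j))) has_field_derivative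
    (\<Sum>l<n. prod_deriv n T Y r $$ (i, l) * (T r $$ (l, j) + 0 * Y r $$ (l, j)) +
       Y r $$ (l, j) * factor_prod n (?T 0) r $$ (i, l))) (at 0)"
    using Suc.IH Suc.prems by (intro DERIV_sum DERIV_mult) (auto intro!: derivative_eq_intros)
  also have "(\<lambda>s. \<Sum>l<n. factor_prod n (?T s) r $$ (i, l) * (T r $$ (l, j) + s * Y r $$ (l, j))) =
      (\<lambda>s. factor_prod n (?T s) (Suc r) $$ (i, j))"
  proof
    fix s
    have "factor_prod n (?T s) (Suc r) $$ (i, j) = (\<Sum>l<n. factor_prod n (?T s) r $$ (i, l) * ?T s r $$ (l, j))"
      unfolding factor_prod.simps using c Suc.prems by (intro mat_mult_entry) auto
    also have "\<dots> = (\<Sum>l<n. factor_prod n (?T s) r $$ (i, l) * (T r $$ (l, j) + s * Y r $$ (l, j)))"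
      using T[of r] Y[of r] Suc.prems by (intro sum.cong refl) auto
    finally show "(\<Sum>l<n. factor_prod n (?T s) r $$ (i, l) * (T r $$ (l, j) + s * Y r $$ (l, j))) =
      factor_prod n (?T s) (Suc r) $$ (i, j)" by simp
  qed
  also have "(\<Sum>l<n. prod_deriv n T Y r $$ (i, l) * (T r $$ (l, j) + 0 * Y r $$ (l, j)) +
       Y r $$ (l, j) * factor_prod n (?T 0) r $$ (i, l)) = prod_deriv n T Y (Suc r) $$ (i, j)"
    unfolding prod_deriv_Suc_entry[OF T Y Suc.prems] T0 sum.distrib by (simp add: mult.commute)
  finally show ?case .
qed

definition lincomb_mat :: "nat \<Rightarrow> 'i set \<Rightarrow> ('i \<Rightarrow> complex) \<Rightarrow> ('i \<Rightarrow> complex mat) \<Rightarrow> complex mat" where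
  "lincomb_mat n P c Y = mat n n (\<lambda>ij. \<Sum>p\<in>P. c p * Y p $$ ij)"

lemma lincomb_mat_carrier [simp]: "lincomb_mat n P c Y \<in> carrier_mat n n"
  by (simp add: lincomb_mat_def)

lemma toeplitz_mat_lincomb:
  assumes "\<And>p. toeplitz_mat n (Y p)"
  shows "toeplitz_mat n (lincomb_mat n P c Y)"
  unfolding toeplitz_mat_def
proof (intro conjI allI impI)
  fix i j i' j' assume *: "i < n" "j < n" "i' < n" "j' < n" "i + j' = i' + j"
  show "lincomb_mat n P c Y $$ (i, j) = lincomb_mat n P c Y $$ (i', j')"
    using * toeplitz_matD[OF assms *] by (simp add: lincomb_mat_def)
qed simp

lemma prod_deriv_lincomb:
  assumes T: "\<And>k. T k \<in> carrier_mat n n" and Y: "\<And>p k. Y p k \<in> carrier_mat n n"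
  shows "prod_deriv n T (\<lambda>k. lincomb_mat n P c (\<lambda>p. Y p k)) r =
    lincomb_mat n P c (\<lambda>p. prod_deriv n T (Y p) r)"
proof (induction r)
  case 0
  show ?case by (auto simp: lincomb_mat_def)
next
  case (Suc r)
  show ?case
  proof (rule eq_matI)
    fix i j assume "i < dim_row (lincomb_mat n P c (\<lambda>p. prod_deriv n T (Y p) (Suc r)))"
      "j < dim_col (lincomb_mat n P c (\<lambda>p. prod_deriv n T (Y p) (Suc r)))"
    hence ij: "i < n" "j < n" by (auto simp: lincomb_mat_def)
    let ?L = "\<lambda>k. lincomb_mat n P c (\<lambda>p. Y p k)"
    have "prod_deriv n T ?L (Suc r) $$ (i, j) =
      (\<Sum>l<n. (\<Sum>p\<in>P. c p * prod_deriv n T (Y p) r $$ (i, l)) * T r $$ (l, j)) +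
      (\<Sum>l<n. factor_prod n T r $$ (i, l) * (\<Sum>p\<in>P. c p * Y p r $$ (l, j)))"
      unfolding prod_deriv_Suc_entry[of T, OF T lincomb_mat_carrier ij] Suc
      using ij by (simp add: lincomb_mat_def)
    also have "\<dots> = (\<Sum>p\<in>P. c p * prod_deriv n T (Y p) (Suc r) $$ (i, j))"
      unfolding prod_deriv_Suc_entry[OF T Y ij] distrib_left sum.distrib sum_distrib_left sum_distrib_right
      by (intro arg_cong2[of _ _ _ _ "(+)"]; subst sum.swap; intro sum.cong refl) (simp_all add: mult_ac)
    finally show "prod_deriv n T ?L (Suc r) $$ (i, j) =
      lincomb_mat n P c (\<lambda>p. prod_deriv n T (Y p) (Suc r)) $$ (i, j)"
      using ij by (simp add: lincomb_mat_def)
  qed (simp_all only: carrier_matD[OF lincomb_mat_carrier]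
      carrier_matD[OF prod_deriv_carrier[of T, OF T lincomb_mat_carrier]])
qed

section \<open>Limits of differentials\<close>

definition mat_tendsto :: "nat \<Rightarrow> (complex \<Rightarrow> complex mat) \<Rightarrow> complex mat \<Rightarrow> bool" where
  "mat_tendsto n F Z \<longleftrightarrow> (\<forall>i<n. \<forall>j<n. ((\<lambda>\<epsilon>. F \<epsilon> $$ (i, j)) \<longlongrightarrow> Z $$ (i, j)) (at 0))"

lemma mat_tendstoD:
  "mat_tendsto n F Z \<Longrightarrow> i < n \<Longrightarrow> j < n \<Longrightarrow> ((\<lambda>\<epsilon>. F \<epsilon> $$ (i, j)) \<longlongrightarrow> Z $$ (i, j)) (at 0)"
  by (simp add: mat_tendsto_def)

lemma mat_tendsto_const: "mat_tendsto n (\<lambda>\<epsilon>. A) A"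
  by (simp add: mat_tendsto_def)

lemma mat_tendsto_mult:
  assumes "\<And>\<epsilon>. F \<epsilon> \<in> carrier_mat n n" "\<And>\<epsilon>. G \<epsilon> \<in> carrier_mat n n"
    "A \<in> carrier_mat n n" "B \<in> carrier_mat n n" "mat_tendsto n F A" "mat_tendsto n G B"
  shows "mat_tendsto n (\<lambda>\<epsilon>. F \<epsilon> * G \<epsilon>) (A * B)"
  unfolding mat_tendsto_def
proof (intro allI impI)
  fix i j assume ij: "i < n" "j < n"
  show "((\<lambda>\<epsilon>. (F \<epsilon> * G \<epsilon>) $$ (i, j)) \<longlongrightarrow> (A * B) $$ (i, j)) (at 0)"
    unfolding mat_mult_entry[OF assms(1,2) ij] mat_mult_entry[OF assms(3,4) ij]
    using assms(5,6) ij by (intro tendsto_intros mat_tendstoD[of n]) auto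
qed

lemma mat_tendsto_eventually_cong:
  assumes "mat_tendsto n F A" "\<And>\<epsilon>. \<epsilon> \<noteq> 0 \<Longrightarrow> F \<epsilon> = G \<epsilon>"
  shows "mat_tendsto n G A"
  unfolding mat_tendsto_def
proof (intro allI impI)
  fix i j assume ij: "i < n" "j < n"
  show "((\<lambda>\<epsilon>. G \<epsilon> $$ (i, j)) \<longlongrightarrow> A $$ (i, j)) (at 0)"
    by (rule Lim_transform_eventually[OF mat_tendstoD[OF assms(1) ij]])
      (auto simp: eventually_at_filter assms(2))
qed

text \<open>
  For \<open>b > 0\<close> this is the sum of the \<open>b\<close>-th powers of the nilpotent shift and of its transpose.
\<close>

definition shift_pair :: "nat \<Rightarrow> nat \<Rightarrow> complex mat" where
  "shift_pair n b = mat n n (\<lambda>(i, j). if i = j + b \<or> j = i + b then 1 else 0)"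

text \<open>
  The powers of \<open>\<epsilon>\<close> grow with \<open>k\<close>, so that in the difference of perturbations of factors \<open>k\<close> and
  \<open>k + 1\<close> the contribution of \<open>k\<close> dominates.
\<close>

definition base_factor :: "nat \<Rightarrow> complex \<Rightarrow> nat \<Rightarrow> complex mat" where
  "base_factor n \<epsilon> k = 1\<^sub>m n + \<epsilon> ^ Suc k \<cdot>\<^sub>m shift_pair n (n - 1 - k)"

lemma shift_pair_carrier [simp]: "shift_pair n b \<in> carrier_mat n n"
  by (simp add: shift_pair_def)

lemma base_factor_carrier [simp]: "base_factor n \<epsilon> k \<in> carrier_mat n n"
  by (simp add: base_factor_def)

lemma toeplitz_base_factor: "toeplitz_mat n (base_factor n \<epsilon> k)"
  unfolding toeplitz_mat_def
proof (intro conjI allI impI)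
  fix i j i' j' assume *: "i < n" "j < n" "i' < n" "j' < n" "i + j' = i' + j"
  have "i = j \<longleftrightarrow> i' = j'" "i = j + b \<longleftrightarrow> i' = j' + b" "j = i + b \<longleftrightarrow> j' = i' + b" for b
    using *(5) by linarith+
  thus "base_factor n \<epsilon> k $$ (i, j) = base_factor n \<epsilon> k $$ (i', j')"
    using *(1-4) by (simp add: base_factor_def shift_pair_def)
qed simp

lemma base_factor_tendsto: "mat_tendsto n (\<lambda>\<epsilon>. base_factor n \<epsilon> k) (1\<^sub>m n)"
  unfolding mat_tendsto_def
proof (intro allI impI)
  fix i j assume ij: "i < n" "j < n"
  have "((\<lambda>\<epsilon>::complex. 1\<^sub>m n $$ (i, j) + \<epsilon> ^ Suc k * shift_pair n (n - 1 - k) $$ (i, j)) \<longlongrightarrow>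
      1\<^sub>m n $$ (i, j) + 0 ^ Suc k * shift_pair n (n - 1 - k) $$ (i, j)) (at 0)"
    by (intro tendsto_intros)
  thus "((\<lambda>\<epsilon>. base_factor n \<epsilon> k $$ (i, j)) \<longlongrightarrow> 1\<^sub>m n $$ (i, j)) (at 0)"
    using ij by (simp add: base_factor_def shift_pair_def)
qed

lemma base_prod_tendsto: "mat_tendsto n (\<lambda>\<epsilon>. factor_prod n (base_factor n \<epsilon>) r) (1\<^sub>m n)"
proof (induction r)
  case 0
  show ?case by (simp add: mat_tendsto_const)
next
  case (Suc r)
  have "mat_tendsto n (\<lambda>\<epsilon>. factor_prod n (base_factor n \<epsilon>) r * base_factor n \<epsilon> r) (1\<^sub>m n * 1\<^sub>m n)"
    by (intro mat_tendsto_mult Suc base_factor_tendsto) auto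
  thus ?case by simp
qed

text \<open>
  The directions \<open>Y\<close> may depend on \<open>\<epsilon>\<close> arbitrarily, and they have poles at \<open>0\<close> in the application;
  only the resulting motion of the product has to converge.
\<close>

definition limit_direction :: "nat \<Rightarrow> nat \<Rightarrow> complex mat \<Rightarrow> bool" where
  "limit_direction n r Z \<longleftrightarrow> Z \<in> carrier_mat n n \<and> (\<exists>Y. (\<forall>\<epsilon> k. toeplitz_mat n (Y \<epsilon> k)) \<and>
     mat_tendsto n (\<lambda>\<epsilon>. prod_deriv n (base_factor n \<epsilon>) (Y \<epsilon>) r) Z)"

lemma limit_directionD:
  "limit_direction n r Z \<Longrightarrow> \<exists>Y. (\<forall>\<epsilon> k. toeplitz_mat n (Y \<epsilon> k)) \<and>
     mat_tendsto n (\<lambda>\<epsilon>. prod_deriv n (base_factor n \<epsilon>) (Y \<epsilon>) r) Z"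
  unfolding limit_direction_def by (rule conjunct2)

lemma toeplitz_zero [simp]: "toeplitz_mat n (0\<^sub>m n n)"
  by (simp add: toeplitz_mat_def)

lemma toeplitz_add_smult:
  assumes A: "toeplitz_mat n A" and B: "toeplitz_mat n B"
  shows "toeplitz_mat n (A + c \<cdot>\<^sub>m B)"
  unfolding toeplitz_mat_def
proof (intro conjI allI impI)
  fix i j i' j' assume *: "i < n" "j < n" "i' < n" "j' < n" "i + j' = i' + j"
  show "(A + c \<cdot>\<^sub>m B) $$ (i, j) = (A + c \<cdot>\<^sub>m B) $$ (i', j')"
    using carrier_matD[OF toeplitz_mat_carrier[OF B]] *(1-4) toeplitz_matD[OF A *] toeplitz_matD[OF B *] by simp
qed (use A B in simp)

lemma toeplitz_smult: "toeplitz_mat n A \<Longrightarrow> toeplitz_mat n (c \<cdot>\<^sub>m A)"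
  using toeplitz_add_smult[OF toeplitz_zero, of n A c] left_add_zero_mat[of "c \<cdot>\<^sub>m A" n n] by simp

text \<open>
  All base factors tend to \<open>1\<close>, so multiplying by further unperturbed ones does not change the limit.
\<close>

lemma prod_deriv_tendsto_propagate:
  assumes Y: "\<And>\<epsilon> k. toeplitz_mat n (Y \<epsilon> k)" and Z: "Z \<in> carrier_mat n n"
    and lim: "mat_tendsto n (\<lambda>\<epsilon>. prod_deriv n (base_factor n \<epsilon>) (Y \<epsilon>) m) Z"
    and zero: "\<And>\<epsilon> k. m \<le> k \<Longrightarrow> Y \<epsilon> k = 0\<^sub>m n n" and "m \<le> r"
  shows "limit_direction n r Z"
proof -
  have c: "prod_deriv n (base_factor n \<epsilon>) (Y \<epsilon>) r \<in> carrier_mat n n" for \<epsilon> r using Y by simp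
  have "mat_tendsto n (\<lambda>\<epsilon>. prod_deriv n (base_factor n \<epsilon>) (Y \<epsilon>) r) Z"
    using \<open>m \<le> r\<close>
  proof (induction r rule: dec_induct)
    case (step r)
    have "mat_tendsto n (\<lambda>\<epsilon>. prod_deriv n (base_factor n \<epsilon>) (Y \<epsilon>) r * base_factor n \<epsilon> r) (Z * 1\<^sub>m n)"
      using c Z by (intro mat_tendsto_mult step.IH base_factor_tendsto) auto
    moreover have "prod_deriv n (base_factor n \<epsilon>) (Y \<epsilon>) (Suc r) =
        prod_deriv n (base_factor n \<epsilon>) (Y \<epsilon>) r * base_factor n \<epsilon> r" for \<epsilon>
    proof -
      have "prod_deriv n (base_factor n \<epsilon>) (Y \<epsilon>) r * base_factor n \<epsilon> r \<in> carrier_mat n n"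
        using c by (intro mult_carrier_mat[of _ n n]) auto
      thus ?thesis
        using zero[OF step.hyps(1)] right_mult_zero_mat[of "factor_prod n (base_factor n \<epsilon>) r" n n n] by simp
    qed
    ultimately show ?case using right_mult_one_mat[OF Z] by simp
  qed (rule lim)
  thus ?thesis unfolding limit_direction_def using Y Z by blast
qed

lemma limit_direction_toeplitz:
  assumes S: "toeplitz_mat n S" and "r > 0"
  shows "limit_direction n r S"
proof (rule prod_deriv_tendsto_propagate[where Y = "\<lambda>\<epsilon> k. if k = 0 then S else 0\<^sub>m n n" and m = 1])
  have "prod_deriv n (base_factor n \<epsilon>) (\<lambda>k. if k = 0 then S else 0\<^sub>m n n) 1 = S" for \<epsilon>
    using S left_mult_zero_mat[of "base_factor n \<epsilon> 0" n n n] left_mult_one_mat[of S n n]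
      left_add_zero_mat[of S n n] by simp
  thus "mat_tendsto n (\<lambda>\<epsilon>. prod_deriv n (base_factor n \<epsilon>) (\<lambda>k. if k = 0 then S else 0\<^sub>m n n) 1) S"
    by (simp add: mat_tendsto_const del: One_nat_def)
qed (use assms in auto)

lemma prod_deriv_zero:
  assumes "\<And>k. T k \<in> carrier_mat n n" "\<And>k. k < r \<Longrightarrow> Y k = 0\<^sub>m n n"
  shows "prod_deriv n T Y r = 0\<^sub>m n n"
  using assms(2)
proof (induction r)
  case (Suc r)
  thus ?case using left_mult_zero_mat[of "T r" n n n] right_mult_zero_mat[of "factor_prod n T r" n n n] assms(1)
    by simp
qed simp

lemma smult_add_smult_mat:
  fixes A B :: "complex mat"
  assumes "A \<in> carrier_mat n n" "B \<in> carrier_mat n n"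
  shows "c \<cdot>\<^sub>m (A + d \<cdot>\<^sub>m B) = c \<cdot>\<^sub>m A + (c * d) \<cdot>\<^sub>m B"
  using assms by (intro eq_matI) (auto simp: distrib_left)

lemma mat_tendsto_add_smult:
  assumes "A \<in> carrier_mat n n" "B \<in> carrier_mat n n"
  shows "mat_tendsto n (\<lambda>\<epsilon>. A + (- \<epsilon>) \<cdot>\<^sub>m B) A"
  unfolding mat_tendsto_def
proof (intro allI impI)
  fix i j assume ij: "i < n" "j < n"
  have "((\<lambda>\<epsilon>. A $$ (i, j) + (- \<epsilon>) * B $$ (i, j)) \<longlongrightarrow> A $$ (i, j) + (- 0) * B $$ (i, j)) (at 0)"
    by (intro tendsto_intros)
  thus "((\<lambda>\<epsilon>. (A + (- \<epsilon>) \<cdot>\<^sub>m B) $$ (i, j)) \<longlongrightarrow> A $$ (i, j)) (at 0)"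
    using ij assms by simp
qed

text \<open>
  With \<open>T\<^sub>k = 1 + \<epsilon>\<^bsup>k+1\<^esup> B\<close> and \<open>T\<^bsub>k+1\<^esub> = 1 + \<epsilon>\<^bsup>k+2\<^esup> B'\<close>, the identity
  \<open>(T\<^sub>k S - S T\<^bsub>k+1\<^esub>) / \<epsilon>\<^bsup>k+1\<^esup> = B S - \<epsilon> S B'\<close> shows that perturbing the two neighbouring factors
  by multiples of \<open>S\<close> of opposite sign isolates \<open>B S\<close>.
\<close>

lemma limit_direction_shift_pair:
  assumes S: "toeplitz_mat n S" and "Suc k < r"
  shows "limit_direction n r (shift_pair n (n - 1 - k) * S)"
proof -
  define Y where "Y \<epsilon> m = (if m = k then (- (1 / \<epsilon> ^ Suc k)) \<cdot>\<^sub>m S else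
    if m = Suc k then (1 / \<epsilon> ^ Suc k) \<cdot>\<^sub>m S else 0\<^sub>m n n)" for \<epsilon> :: complex and m
  let ?T = "base_factor n" and ?P = "\<lambda>\<epsilon>. factor_prod n (base_factor n \<epsilon>)"
  let ?B = "shift_pair n (n - 1 - k)" and ?B' = "shift_pair n (n - 1 - Suc k)"
  have S': "S \<in> carrier_mat n n" using S by simp
  have Y: "toeplitz_mat n (Y \<epsilon> m)" for \<epsilon> m using S by (auto simp: Y_def toeplitz_smult)
  have Yc: "Y \<epsilon> m \<in> carrier_mat n n" for \<epsilon> m using Y by simp
  have c: "?P \<epsilon> m \<in> carrier_mat n n" "?T \<epsilon> m \<in> carrier_mat n n" for \<epsilon> m by auto
  note mc = mult_carrier_mat[of _ n n _ n]
  have one_smult: "1 \<cdot>\<^sub>m A = A" for A :: "complex mat" by (rule eq_matI) auto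
  have key: "prod_deriv n (?T \<epsilon>) (Y \<epsilon>) (Suc (Suc k)) = ?P \<epsilon> k * (?B * S + (- \<epsilon>) \<cdot>\<^sub>m (S * ?B'))" if "\<epsilon> \<noteq> 0" for \<epsilon>
  proof -
    have "prod_deriv n (?T \<epsilon>) (Y \<epsilon>) k = 0\<^sub>m n n"
      by (rule prod_deriv_zero) (auto simp: Y_def)
    hence "prod_deriv n (?T \<epsilon>) (Y \<epsilon>) (Suc k) = ?P \<epsilon> k * Y \<epsilon> k"
      using left_mult_zero_mat[OF c(2)] left_add_zero_mat[OF mc[OF c(1) Yc]] by simp
    hence "prod_deriv n (?T \<epsilon>) (Y \<epsilon>) (Suc (Suc k)) =
        ?P \<epsilon> k * Y \<epsilon> k * ?T \<epsilon> (Suc k) + ?P \<epsilon> k * ?T \<epsilon> k * Y \<epsilon> (Suc k)" by simp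
    also have "\<dots> = ?P \<epsilon> k * (Y \<epsilon> k * ?T \<epsilon> (Suc k)) + ?P \<epsilon> k * (?T \<epsilon> k * Y \<epsilon> (Suc k))"
      by (simp only: assoc_mult_mat[OF c(1) Yc c(2)] assoc_mult_mat[OF c(1) c(2) Yc])
    also have "\<dots> = ?P \<epsilon> k * (Y \<epsilon> k * ?T \<epsilon> (Suc k) + ?T \<epsilon> k * Y \<epsilon> (Suc k))"
      by (rule mult_add_distrib_mat[symmetric, OF c(1) mc[OF Yc c(2)] mc[OF c(2) Yc]])
    also have "Y \<epsilon> k * ?T \<epsilon> (Suc k) + ?T \<epsilon> k * Y \<epsilon> (Suc k) = ?B * S + (- \<epsilon>) \<cdot>\<^sub>m (S * ?B')"
    proof -
      let ?c = "1 / \<epsilon> ^ Suc k"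
      have 1: "Y \<epsilon> k * ?T \<epsilon> (Suc k) = (- ?c) \<cdot>\<^sub>m S + (- \<epsilon>) \<cdot>\<^sub>m (S * ?B')"
      proof -
        have "Y \<epsilon> k * ?T \<epsilon> (Suc k) = (- ?c) \<cdot>\<^sub>m (S * ?T \<epsilon> (Suc k))"
          using mult_smult_assoc_mat[OF S' c(2)] by (simp add: Y_def)
        also have "S * ?T \<epsilon> (Suc k) = S + \<epsilon> ^ Suc (Suc k) \<cdot>\<^sub>m (S * ?B')"
          unfolding base_factor_def
          by (subst mult_add_distrib_mat[OF S' one_carrier_mat smult_carrier_mat[OF shift_pair_carrier]])
            (simp only: right_mult_one_mat[OF S'] mult_smult_distrib[OF S' shift_pair_carrier])
        also have "(- ?c) \<cdot>\<^sub>m (S + \<epsilon> ^ Suc (Suc k) \<cdot>\<^sub>m (S * ?B')) = (- ?c) \<cdot>\<^sub>m S + (- \<epsilon>) \<cdot>\<^sub>m (S * ?B')"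
          using smult_add_smult_mat[OF S' mc[OF S' shift_pair_carrier], of "- ?c" "\<epsilon> ^ Suc (Suc k)"] that by simp
        finally show ?thesis .
      qed
      have 2: "?T \<epsilon> k * Y \<epsilon> (Suc k) = ?c \<cdot>\<^sub>m S + ?B * S"
      proof -
        have "?T \<epsilon> k * Y \<epsilon> (Suc k) = ?c \<cdot>\<^sub>m (?T \<epsilon> k * S)"
          using mult_smult_distrib[OF c(2) S'] by (simp add: Y_def)
        also have "?T \<epsilon> k * S = S + \<epsilon> ^ Suc k \<cdot>\<^sub>m (?B * S)"
          unfolding base_factor_def
          by (subst add_mult_distrib_mat[OF one_carrier_mat smult_carrier_mat[OF shift_pair_carrier] S'])
            (simp only: left_mult_one_mat[OF S'] mult_smult_assoc_mat[OF shift_pair_carrier S'])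
        also have "?c \<cdot>\<^sub>m (S + \<epsilon> ^ Suc k \<cdot>\<^sub>m (?B * S)) = ?c \<cdot>\<^sub>m S + ?B * S"
          using smult_add_smult_mat[OF S' mc[OF shift_pair_carrier S'], of ?c "\<epsilon> ^ Suc k"] that
          by (simp add: one_smult)
        finally show ?thesis .
      qed
      have "(a \<cdot>\<^sub>m S + C) + (b \<cdot>\<^sub>m S + A) = A + C" if "a = - b" "A \<in> carrier_mat n n" "C \<in> carrier_mat n n"
        for a b :: complex and A C
        by (rule eq_matI) (use S' that in auto)
      from this[of "- ?c" ?c, OF _ mc[OF shift_pair_carrier S'] smult_carrier_mat[OF mc[OF S' shift_pair_carrier]]]
      show ?thesis unfolding 1 2 by blast
    qed
    finally show ?thesis .
  qed
  have "mat_tendsto n (\<lambda>\<epsilon>. ?B * S + (- \<epsilon>) \<cdot>\<^sub>m (S * ?B')) (?B * S)"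
    by (rule mat_tendsto_add_smult[OF mc[OF shift_pair_carrier S'] mc[OF S' shift_pair_carrier]])
  hence "mat_tendsto n (\<lambda>\<epsilon>. ?P \<epsilon> k * (?B * S + (- \<epsilon>) \<cdot>\<^sub>m (S * ?B'))) (1\<^sub>m n * (?B * S))"
    using S' by (intro mat_tendsto_mult base_prod_tendsto) (auto intro!: add_carrier_mat mc)
  hence "mat_tendsto n (\<lambda>\<epsilon>. prod_deriv n (?T \<epsilon>) (Y \<epsilon>) (Suc (Suc k))) (?B * S)"
    unfolding left_mult_one_mat[OF mc[OF shift_pair_carrier S']]
    by (rule mat_tendsto_eventually_cong) (erule key[symmetric])
  thus ?thesis
    by (rule prod_deriv_tendsto_propagate[where Y = Y, OF Y mc[OF shift_pair_carrier S']])
      (use assms(2) in \<open>auto simp: Y_def\<close>)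
qed

lemma limit_direction_diff:
  assumes A: "limit_direction n r A" and B: "limit_direction n r B"
  shows "limit_direction n r (A - B)"
proof -
  from limit_directionD[OF A] obtain Y where
    Y: "(\<forall>\<epsilon> k. toeplitz_mat n (Y \<epsilon> k)) \<and>
      mat_tendsto n (\<lambda>\<epsilon>. prod_deriv n (base_factor n \<epsilon>) (Y \<epsilon>) r) A" ..
  note Y = conjunct1[OF Y, rule_format] conjunct2[OF Y]
  from limit_directionD[OF B] obtain Z where
    Z: "(\<forall>\<epsilon> k. toeplitz_mat n (Z \<epsilon> k)) \<and>
      mat_tendsto n (\<lambda>\<epsilon>. prod_deriv n (base_factor n \<epsilon>) (Z \<epsilon>) r) B" ..
  note Z = conjunct1[OF Z, rule_format] conjunct2[OF Z]
  define W where "W \<epsilon> b = (if b then Y \<epsilon> else Z \<epsilon>)" for \<epsilon> b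
  define c :: "bool \<Rightarrow> complex" where "c b = (if b then 1 else - 1)" for b
  have W: "toeplitz_mat n (W \<epsilon> b k)" for \<epsilon> b k
    by (cases b) (simp_all only: W_def if_True if_False Y(1) Z(1))
  define X where "X \<epsilon> k = lincomb_mat n UNIV c (\<lambda>b. W \<epsilon> b k)" for \<epsilon> k
  have "mat_tendsto n (\<lambda>\<epsilon>. prod_deriv n (base_factor n \<epsilon>) (X \<epsilon>) r) (A - B)"
    unfolding mat_tendsto_def
  proof (intro allI impI)
    fix i j assume ij: "i < n" "j < n"
    have "prod_deriv n (base_factor n \<epsilon>) (X \<epsilon>) r $$ (i, j) =
      prod_deriv n (base_factor n \<epsilon>) (Y \<epsilon>) r $$ (i, j) - prod_deriv n (base_factor n \<epsilon>) (Z \<epsilon>) r $$ (i, j)" for \<epsilon>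
    proof -
      have "prod_deriv n (base_factor n \<epsilon>) (X \<epsilon>) r =
          lincomb_mat n UNIV c (\<lambda>b. prod_deriv n (base_factor n \<epsilon>) (W \<epsilon> b) r)"
        unfolding X_def by (rule prod_deriv_lincomb[OF base_factor_carrier toeplitz_mat_carrier[OF W]])
      thus ?thesis using ij by (simp add: lincomb_mat_def UNIV_bool c_def W_def)
    qed
    moreover have "((\<lambda>\<epsilon>. prod_deriv n (base_factor n \<epsilon>) (Y \<epsilon>) r $$ (i, j) -
        prod_deriv n (base_factor n \<epsilon>) (Z \<epsilon>) r $$ (i, j)) \<longlongrightarrow> A $$ (i, j) - B $$ (i, j)) (at 0)"
      by (intro tendsto_diff mat_tendstoD[OF Y(2) ij] mat_tendstoD[OF Z(2) ij])
    moreover have "(A - B) $$ (i, j) = A $$ (i, j) - B $$ (i, j)"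
      using ij A B unfolding limit_direction_def by (intro index_minus_mat(1)) auto
    ultimately show "((\<lambda>\<epsilon>. prod_deriv n (base_factor n \<epsilon>) (X \<epsilon>) r $$ (i, j)) \<longlongrightarrow> (A - B) $$ (i, j)) (at 0)"
      by simp
  qed
  moreover have "toeplitz_mat n (X \<epsilon> k)" for \<epsilon> k unfolding X_def by (rule toeplitz_mat_lincomb[OF W])
  moreover have "A - B \<in> carrier_mat n n" using A B unfolding limit_direction_def by auto
  ultimately show ?thesis unfolding limit_direction_def by blast
qed

section \<open>The limit directions span\<close>

text \<open>
  The matrix of the coordinates of the vectors \<open>v \<epsilon> k\<close> tends to the identity, so its determinant
  is nonzero for some \<open>\<epsilon>\<close>.
\<close>

lemma perturbed_basis_spans:
  fixes v :: "complex \<Rightarrow> nat \<Rightarrow> nat \<Rightarrow> complex"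
  assumes "\<And>k l. k < N \<Longrightarrow> l < N \<Longrightarrow> ((\<lambda>\<epsilon>. v \<epsilon> k l) \<longlongrightarrow> (if k = l then 1 else 0)) (at 0)"
  shows "\<exists>\<epsilon>. \<forall>z. \<exists>c. \<forall>l<N. (\<Sum>k<N. c k * v \<epsilon> k l) = z l"
proof -
  define M where "M \<epsilon> = mat N N (\<lambda>(k, l). v \<epsilon> k l)" for \<epsilon>
  have M: "M \<epsilon> \<in> carrier_mat N N" for \<epsilon> by (simp add: M_def)
  have "((\<lambda>\<epsilon>. det (M \<epsilon>)) \<longlongrightarrow> det (1\<^sub>m N)) (at 0)"
    unfolding det_def'[OF M] det_def'[OF one_carrier_mat]
  proof (intro tendsto_intros)
    fix p i assume p: "p \<in> {p. p permutes {0..<N}}" "i \<in> {0..<N}"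
    hence "p i < N" using permutes_in_image[of p "{0..<N}" i] by auto
    with p(2) assms[of i "p i"] show "((\<lambda>\<epsilon>. M \<epsilon> $$ (i, p i)) \<longlongrightarrow> 1\<^sub>m N $$ (i, p i)) (at 0)"
      by (simp add: M_def)
  qed
  hence "eventually (\<lambda>\<epsilon>. det (M \<epsilon>) \<noteq> 0) (at 0)"
    by (intro tendsto_imp_eventually_ne) auto
  then obtain \<epsilon> where "det (M \<epsilon>) \<noteq> 0"
    using eventually_happens'[OF at_neq_bot] by blast
  from det_non_zero_imp_unit[OF M this] obtain B where
    B: "B \<in> carrier_mat N N" "B * M \<epsilon> = 1\<^sub>m N"
    unfolding Units_def ring_mat_def by auto
  have "\<exists>c. \<forall>l<N. (\<Sum>k<N. c k * v \<epsilon> k l) = z l" for z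
  proof (rule exI[of _ "\<lambda>k. \<Sum>m<N. z m * B $$ (m, k)"], intro allI impI)
    fix l assume l: "l < N"
    have "(\<Sum>k<N. B $$ (m, k) * v \<epsilon> k l) = (if m = l then 1 else 0)" if m: "m < N" for m
    proof -
      have "(B * M \<epsilon>) $$ (m, l) = (\<Sum>k<N. B $$ (m, k) * v \<epsilon> k l)"
        using B(1) m l by (simp add: M_def scalar_prod_def atLeast0LessThan)
      thus ?thesis using B(2) m l by simp
    qed
    hence "(\<Sum>m<N. z m * (\<Sum>k<N. B $$ (m, k) * v \<epsilon> k l)) = (\<Sum>m<N. if m = l then z m else 0)"
      by (intro sum.cong) auto
    also have "\<dots> = z l" using l by simp
    finally show "(\<Sum>k<N. (\<Sum>m<N. z m * B $$ (m, k)) * v \<epsilon> k l) = z l"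
      unfolding sum_distrib_left sum_distrib_right
      by (subst sum.swap) (simp add: mult.assoc)
  qed
  thus ?thesis by blast
qed

lemma shift_pair_mult_entry:
  assumes S: "S \<in> carrier_mat n n" and ij: "i < n" "j < n" and "b > 0"
  shows "(shift_pair n b * S) $$ (i, j) =
    (if b \<le> i then S $$ (i - b, j) else 0) + (if i + b < n then S $$ (i + b, j) else 0)"
proof -
  have "(shift_pair n b * S) $$ (i, j) = (\<Sum>l<n. (if l = i - b then if b \<le> i then S $$ (l, j) else 0 else 0) +
      (if l = i + b then S $$ (l, j) else 0))"
    unfolding mat_mult_entry[OF shift_pair_carrier S ij] using ij \<open>b > 0\<close>
    by (intro sum.cong) (auto simp: shift_pair_def)
  thus ?thesis using ij by (cases "b \<le> i") (simp_all add: sum.distrib)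
qed

text \<open>
  The indicator of the entries in rows \<open>\<ge> k\<close> of one diagonal. The diagonals are numbered by
  \<open>s = i + (n - 1 - j)\<close>, which avoids negative numbers.
\<close>

definition diagonal_tail :: "nat \<Rightarrow> nat \<Rightarrow> nat \<Rightarrow> complex mat" where
  "diagonal_tail n s k = mat n n (\<lambda>(i, j). if i + (n - 1 - j) = s \<and> k \<le> i then 1 else 0)"

lemma diagonal_tail_carrier [simp]: "diagonal_tail n s k \<in> carrier_mat n n"
  by (simp add: diagonal_tail_def)

lemma toeplitz_indicator:
  "toeplitz_mat n (mat n n (\<lambda>(i, j). if P (i + (n - 1 - j)) then 1 else 0))"
  unfolding toeplitz_mat_def
proof (intro conjI allI impI)
  fix i j i' j' assume *: "i < n" "j < n" "i' < n" "j' < n" "i + j' = i' + j"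
  hence "i + (n - 1 - j) = i' + (n - 1 - j')" by linarith
  thus "mat n n (\<lambda>(i, j). if P (i + (n - 1 - j)) then 1 else (0::complex)) $$ (i, j) =
    mat n n (\<lambda>(i, j). if P (i + (n - 1 - j)) then 1 else 0) $$ (i', j')"
    using * by simp
qed simp

lemma toeplitz_diagonal: "toeplitz_mat n (diagonal_tail n s 0)"
  using toeplitz_indicator[of n "\<lambda>m. m = s"] by (simp add: diagonal_tail_def)

text \<open>
  Multiplying the indicator of a whole diagonal by \<open>shift_pair n b\<close> gives two diagonals, one shifted
  down and one shifted up by \<open>b\<close> rows. If the original diagonal is on one side of the main one, then
  one of the two images is a whole diagonal and the other one is truncated. Subtracting the whole
  one, which is Toeplitz, leaves a tail of a diagonal starting at row \<open>b\<close>, or a head ending before row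
  \<open>n - b\<close>. The available distances are those with \<open>n \<le> 2 * b\<close>: the tails give all truncations at
  rows \<open>k\<close> with \<open>n \<le> 2 * k\<close>, and the heads give the remaining ones.
\<close>

lemma limit_direction_diagonal_tail:
  assumes "r = n div 2 + 1"
  shows "limit_direction n r (diagonal_tail n s k)"
proof -
  have toep: "limit_direction n r S" if "toeplitz_mat n S" for S
    using limit_direction_toeplitz[OF that, of r] assms by simp
  consider "k + n \<le> s + 1 \<or> k = 0" | "s < k \<or> n \<le> k" | "k > 0" "k < n" "k \<le> s" "s + 1 < k + n" "n \<le> 2 * k"
    | "k > 0" "k < n" "k \<le> s" "s + 1 < k + n" "2 * k < n" by linarith
  thus ?thesis
  proof cases
    case 1
    hence "diagonal_tail n s k = diagonal_tail n s 0"
      unfolding diagonal_tail_def by (intro cong_mat) auto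
    thus ?thesis using toep[OF toeplitz_diagonal] by simp
  next
    case 2
    hence "diagonal_tail n s k = 0\<^sub>m n n"
      unfolding diagonal_tail_def by (intro eq_matI) auto
    thus ?thesis using toep[OF toeplitz_zero] by simp
  next
    case 3
    let ?S = "diagonal_tail n (s - k) 0" and ?R = "mat n n (\<lambda>(i, j). if i + (n - 1 - j) + 2 * k = s then 1 else 0)"
    have "limit_direction n r (shift_pair n (n - 1 - (n - 1 - k)) * ?S)"
      by (rule limit_direction_shift_pair[OF toeplitz_diagonal]) (use 3 assms in linarith)
    hence "limit_direction n r (shift_pair n k * ?S)" using 3 by simp
    moreover have "toeplitz_mat n ?R" by (rule toeplitz_indicator[of n "\<lambda>m. m + 2 * k = s"])
    ultimately have "limit_direction n r (shift_pair n k * ?S - ?R)"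
      by (rule limit_direction_diff[OF _ toep])
    moreover have "shift_pair n k * ?S - ?R = diagonal_tail n s k"
    proof (rule eq_matI)
      fix i j assume "i < dim_row (diagonal_tail n s k)" "j < dim_col (diagonal_tail n s k)"
      hence ij: "i < n" "j < n" by (auto simp: diagonal_tail_def)
      define p where "p = n - 1 - j"
      have D: "diagonal_tail n s' k' $$ (a, j) = (if a + p = s' \<and> k' \<le> a then 1 else 0)" if "a < n" for a s' k'
        using that ij by (simp add: diagonal_tail_def p_def)
      have a: "i - k + p = s - k \<longleftrightarrow> i + p = s" if "k \<le> i" using that 3 by linarith
      have R: "?R $$ (i, j) = (if i + p + 2 * k = s then 1 else 0)"
        using ij by (simp add: p_def)
      have b: "i + k < n \<and> i + k + p = s - k \<longleftrightarrow> i + p + 2 * k = s" using 3 by linarith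
      have "(shift_pair n k * ?S - ?R) $$ (i, j) = (shift_pair n k * ?S) $$ (i, j) - ?R $$ (i, j)"
        using ij by (subst index_minus_mat(1)) auto
      also have "\<dots> = diagonal_tail n s k $$ (i, j)"
        unfolding shift_pair_mult_entry[OF diagonal_tail_carrier ij \<open>k > 0\<close>] R
        using ij a b by (cases "k \<le> i"; cases "i + k < n"; cases "i + p + 2 * k = s")
          (simp_all add: D)
      finally show "(shift_pair n k * ?S - ?R) $$ (i, j) = diagonal_tail n s k $$ (i, j)" .
    qed (auto simp: diagonal_tail_def)
    ultimately show ?thesis by simp
  next
    case 4
    define b where "b = n - k"
    let ?S = "diagonal_tail n (s + b) 0" and ?R = "diagonal_tail n (s + b + b) 0"
    have "limit_direction n r (shift_pair n (n - 1 - (k - 1)) * ?S)"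
      by (rule limit_direction_shift_pair[OF toeplitz_diagonal]) (use 4 assms in linarith)
    hence "limit_direction n r (shift_pair n b * ?S)" using 4 by (simp add: b_def)
    hence "limit_direction n r (diagonal_tail n s 0 - (shift_pair n b * ?S - ?R))"
      by (rule limit_direction_diff[OF toep[OF toeplitz_diagonal] limit_direction_diff[OF _ toep[OF toeplitz_diagonal]]])
    moreover have "diagonal_tail n s 0 - (shift_pair n b * ?S - ?R) = diagonal_tail n s k"
    proof (rule eq_matI)
      fix i j assume "i < dim_row (diagonal_tail n s k)" "j < dim_col (diagonal_tail n s k)"
      hence ij: "i < n" "j < n" by (auto simp: diagonal_tail_def)
      have b: "b > 0" "k + b = n" using 4 by (auto simp: b_def)
      define p where "p = n - 1 - j"
      have D: "diagonal_tail n s' k' $$ (a, j) = (if a + p = s' \<and> k' \<le> a then 1 else 0)" if "a < n" for a s' k'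
        using that ij by (simp add: diagonal_tail_def p_def)
      have p: "p < n" using ij by (simp add: p_def)
      have eqs: "i + b < n \<longleftrightarrow> i < k" "i + b + p = s + b \<longleftrightarrow> i + p = s" using b by linarith+
      have eq: "i - b + p = s + b \<longleftrightarrow> i + p = s + b + b" if "b \<le> i" using that by linarith
      have ge: "b \<le> i" if "i + p = s + b + b" using that p b 4 by linarith
      have "(diagonal_tail n s 0 - (shift_pair n b * ?S - ?R)) $$ (i, j) =
        diagonal_tail n s 0 $$ (i, j) - ((shift_pair n b * ?S) $$ (i, j) - ?R $$ (i, j))"
        using ij carrier_matD[OF diagonal_tail_carrier] by (simp del: index_mult_mat(1))
      also have "\<dots> = diagonal_tail n s k $$ (i, j)"
        unfolding shift_pair_mult_entry[OF diagonal_tail_carrier ij b(1)]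
        unfolding eqs using ij eqs eq ge by (cases "b \<le> i"; cases "i < k") (auto simp: D)
      finally show "(diagonal_tail n s 0 - (shift_pair n b * ?S - ?R)) $$ (i, j) = diagonal_tail n s k $$ (i, j)" .
    qed (auto simp: diagonal_tail_def)
    ultimately show ?thesis by simp
  qed
qed

text \<open>
  A matrix unit is the difference of two consecutive tails of its diagonal.
\<close>

lemma limit_direction_unit:
  assumes "a < n" "b < n" "r = n div 2 + 1"
  shows "limit_direction n r (mat n n (\<lambda>ij. if ij = (a, b) then 1 else 0))"
proof -
  let ?s = "a + (n - 1 - b)"
  have "mat n n (\<lambda>ij. if ij = (a, b) then 1 else 0) = diagonal_tail n ?s a - diagonal_tail n ?s (Suc a)"
    by (rule eq_matI) (use assms in \<open>auto simp: diagonal_tail_def\<close>)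
  thus ?thesis
    using limit_direction_diff[OF limit_direction_diagonal_tail[OF assms(3)] limit_direction_diagonal_tail[OF assms(3)]]
    by simp
qed

text \<open>
  The matrix units are limit directions, so by \<open>perturbed_basis_spans\<close> the directions approximating
  them already span for some \<open>\<epsilon>\<close>.
\<close>

lemma toeplitz_product_submersion:
  assumes r: "r = n div 2 + 1"
  shows "\<exists>T. (\<forall>k. toeplitz_mat n (T k)) \<and>
    (\<forall>Z \<in> carrier_mat n n. \<exists>Y. (\<forall>k. toeplitz_mat n (Y k)) \<and> prod_deriv n T Y r = Z)"
proof -
  let ?e = "\<lambda>k. mat n n (\<lambda>ij. if ij = (k div n, k mod n) then 1 else (0 :: complex))"
  have code: "k div n < n" "k mod n < n" if "k < n * n" for k
    using that by (cases "n = 0"; simp add: less_mult_imp_div_less)+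
  let ?P = "\<lambda>k Y. (\<forall>\<epsilon> m. toeplitz_mat n (Y \<epsilon> m)) \<and>
      mat_tendsto n (\<lambda>\<epsilon>. prod_deriv n (base_factor n \<epsilon>) (Y \<epsilon>) r) (?e k)"
  define Y where "Y k = (if k < n * n then SOME Y. ?P k Y else (\<lambda>\<epsilon> m. 0\<^sub>m n n))" for k
  have Y: "?P k (Y k)" if "k < n * n" for k
    unfolding Y_def if_P[OF that]
    by (rule someI_ex[OF limit_directionD[OF limit_direction_unit[OF code[OF that] r]]])
  have Yt: "toeplitz_mat n (Y k \<epsilon> m)" for k \<epsilon> m
    by (cases "k < n * n") (simp_all only: Y, simp add: Y_def)
  have Yc: "Y k \<epsilon> m \<in> carrier_mat n n" for k \<epsilon> m by (rule toeplitz_mat_carrier[OF Yt])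
  have Ylim: "mat_tendsto n (\<lambda>\<epsilon>. prod_deriv n (base_factor n \<epsilon>) (Y k \<epsilon>) r) (?e k)" if "k < n * n" for k
    by (rule conjunct2[OF Y[OF that]])
  \<comment> \<open>A matrix is read as a vector of length \<open>n * n\<close>, entry \<open>l\<close> being the one at \<open>(l div n, l mod n)\<close>.\<close>
  define v where "v \<epsilon> k l = prod_deriv n (base_factor n \<epsilon>) (Y k \<epsilon>) r $$ (l div n, l mod n)" for \<epsilon> k l
  have "((\<lambda>\<epsilon>. v \<epsilon> k l) \<longlongrightarrow> (if k = l then 1 else 0)) (at 0)" if "k < n * n" "l < n * n" for k l
  proof -
    have "(l div n, l mod n) = (k div n, k mod n) \<longleftrightarrow> k = l" by (metis div_mult_mod_eq prod.inject)
    thus ?thesis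
      using mat_tendstoD[OF Ylim[OF that(1)] code(1)[OF that(2)] code(2)[OF that(2)]] code[OF that(2)]
      by (simp add: v_def)
  qed
  from perturbed_basis_spans[of "n * n" v, OF this] obtain \<epsilon> where
    \<epsilon>: "\<And>z. \<exists>c. \<forall>l<n * n. (\<Sum>k<n * n. c k * v \<epsilon> k l) = z l" by blast
  show ?thesis
  proof (rule exI[of _ "base_factor n \<epsilon>"], intro conjI allI ballI)
    fix Z :: "complex mat" assume Z: "Z \<in> carrier_mat n n"
    obtain c where c: "\<And>l. l < n * n \<Longrightarrow> (\<Sum>k<n * n. c k * v \<epsilon> k l) = Z $$ (l div n, l mod n)"
      using \<epsilon>[of "\<lambda>l. Z $$ (l div n, l mod n)"] by blast
    let ?L = "\<lambda>m. lincomb_mat n {..<n * n} c (\<lambda>k. Y k \<epsilon> m)"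
    have "prod_deriv n (base_factor n \<epsilon>) ?L r = Z"
    proof (rule eq_matI)
      fix i j assume "i < dim_row Z" "j < dim_col Z"
      hence ij: "i < n" "j < n" using Z by auto
      define l where "l = i * n + j"
      have l: "l div n = i" "l mod n = j" using ij by (auto simp: l_def)
      have "l < n * n"
      proof -
        have "l < Suc i * n" using ij by (simp add: l_def)
        also have "\<dots> \<le> n * n" using ij by (intro mult_right_mono) auto
        finally show ?thesis .
      qed
      from c[OF this] show "prod_deriv n (base_factor n \<epsilon>) ?L r $$ (i, j) = Z $$ (i, j)"
        unfolding prod_deriv_lincomb[OF base_factor_carrier Yc] using ij
        by (simp add: lincomb_mat_def v_def l)
    qed (simp_all only: carrier_matD[OF Z]
        carrier_matD[OF prod_deriv_carrier[OF base_factor_carrier lincomb_mat_carrier]])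
    thus "\<exists>Y. (\<forall>k. toeplitz_mat n (Y k)) \<and> prod_deriv n (base_factor n \<epsilon>) Y r = Z"
      by (intro exI[of _ ?L] conjI allI toeplitz_mat_lincomb Yt)
  qed (rule toeplitz_base_factor)
qed

section \<open>Density of Hankel products\<close>

text \<open>
  The variables are the matrix entries, \<open>Inl (i, j)\<close>. The type \<open>'p\<close> leaves room for parameters: the
  lemma is applied to a condition from which the antidiagonal values of the factors have been
  eliminated.
\<close>

theorem hankel_products_dense:
  fixes f :: "(nat \<times> nat + 'p \<Rightarrow> complex) \<Rightarrow> complex"
  assumes f: "poly_fun (Inl ` ({..<n} \<times> {..<n})) f"
    and vanish: "\<And>x A. hankel_product n (n div 2 + 1) A \<Longrightarrow> A \<in> carrier_mat n n \<Longrightarrow>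
      (\<And>i j. i < n \<Longrightarrow> j < n \<Longrightarrow> x (Inl (i, j)) = A $$ (i, j)) \<Longrightarrow> f x = 0"
  shows "f x = 0"
proof -
  define r where "r = n div 2 + 1"
  obtain T where T: "\<And>k. toeplitz_mat n (T k)" and
    sub: "\<And>Z. Z \<in> carrier_mat n n \<Longrightarrow> \<exists>Y. (\<forall>k. toeplitz_mat n (Y k)) \<and> prod_deriv n T Y r = Z"
    using toeplitz_product_submersion[OF r_def] by blast
  have Tc: "T k \<in> carrier_mat n n" for k using T by simp
  define env :: "complex mat \<Rightarrow> nat \<times> nat + 'p \<Rightarrow> complex" where
    "env A v = (case v of Inl ij \<Rightarrow> A $$ ij | Inr _ \<Rightarrow> 0)" for A v
  let ?E = "exchange n r" and ?\<pi> = "\<lambda>j. if even r then j else n - 1 - j"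
  show ?thesis
  proof (rule poly_fun_zero_if_vanishes_along_curves[OF f, of "env (factor_prod n T r * ?E)"])
    fix z :: "nat \<times> nat + 'p \<Rightarrow> complex"
    define Z where "Z = mat n n (\<lambda>ij. z (Inl ij))"
    have Z: "Z \<in> carrier_mat n n" by (simp add: Z_def)
    obtain Y where Y: "\<And>k. toeplitz_mat n (Y k)" "prod_deriv n T Y r = Z * ?E"
      using sub[of "Z * ?E"] mult_carrier_mat[OF Z exchange_carrier] by blast
    have Yc: "Y k \<in> carrier_mat n n" for k using Y by simp
    let ?A = "\<lambda>s. factor_prod n (\<lambda>k. T k + s \<cdot>\<^sub>m Y k) r"
    have TY: "toeplitz_mat n (T k + s \<cdot>\<^sub>m Y k)" for k s
      by (rule toeplitz_add_smult[OF T Y(1)])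
    have Ac: "?A s \<in> carrier_mat n n" for s using TY by (intro factor_prod_carrier) auto
    have "T k + 0 \<cdot>\<^sub>m Y k = T k" for k
      by (rule eq_matI) (use Tc[of k] Yc[of k] in auto)
    hence T0: "(\<lambda>k. T k + 0 \<cdot>\<^sub>m Y k) = T" by (rule ext)
    show "\<exists>\<gamma>. (\<forall>s. f (\<gamma> s) = 0) \<and> (\<forall>v\<in>Inl ` ({..<n} \<times> {..<n}).
        \<gamma> 0 v = env (factor_prod n T r * ?E) v \<and> ((\<lambda>s. \<gamma> s v) has_field_derivative z v) (at 0))"
    proof (rule exI[of _ "\<lambda>s. env (?A s * ?E)"], intro conjI allI ballI)
      fix s
      show "f (env (?A s * ?E)) = 0"
        by (rule vanish[of "?A s * ?E"])
          (use toeplitz_product_is_hankel_product[of n "\<lambda>k. T k + s \<cdot>\<^sub>m Y k" r, OF TY] mult_carrier_mat[OF Ac exchange_carrier]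
            in \<open>auto simp: r_def env_def\<close>)
    next
      fix v :: "nat \<times> nat + 'p" assume "v \<in> Inl ` ({..<n} \<times> {..<n})"
      then obtain i j where v: "v = Inl (i, j)" and ij: "i < n" "j < n" by auto
      have p: "?\<pi> j < n" "?\<pi> (?\<pi> j) = j" using ij by auto
      show "env (?A 0 * ?E) v = env (factor_prod n T r * ?E) v" by (simp only: T0)
      have e1: "(\<lambda>s. env (?A s * ?E) v) = (\<lambda>s. ?A s $$ (i, ?\<pi> j))"
        using mult_exchange(1)[OF Ac ij] by (simp add: v env_def del: index_mult_mat(1))
      have e2: "prod_deriv n T Y r $$ (i, ?\<pi> j) = z v"
        unfolding Y(2) mult_exchange(1)[OF Z ij(1) p(1)] p(2) using ij by (simp add: Z_def v)
      show "((\<lambda>s. env (?A s * ?E) v) has_field_derivative z v) (at 0)"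
        unfolding e1 e2[symmetric] by (rule has_field_derivative_factor_prod[OF Tc Yc ij(1) p(1)])
    qed
  qed
qed

section \<open>Hankel products as a polynomial map\<close>

definition hankel_of :: "nat \<Rightarrow> (nat \<times> nat \<Rightarrow> complex) \<Rightarrow> nat \<Rightarrow> complex mat" where
  "hankel_of n x k = mat n n (\<lambda>(i, j). x (k, i + j))"

lemma hankel_of_carrier [simp]: "hankel_of n x k \<in> carrier_mat n n"
  by (simp add: hankel_of_def)

lemma hankel_of_entry: "i < n \<Longrightarrow> j < n \<Longrightarrow> hankel_of n x k $$ (i, j) = x (k, i + j)"
  by (simp add: hankel_of_def)

text \<open>
  Antidiagonal \<open>d\<close> of a Hankel matrix is read off at row \<open>min d (n - 1)\<close>, where it always meets the
  square.
\<close>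

lemma hankel_product_iff:
  "hankel_product n r A \<longleftrightarrow> (\<exists>x. A = factor_prod n (hankel_of n x) r)"
proof
  assume "hankel_product n r A"
  then obtain Hs where Hs: "length Hs = r" "\<forall>H \<in> set Hs. hankel_mat n H" "A = foldr (*) Hs (1\<^sub>m n)"
    unfolding hankel_product_def by blast
  define x where "x = (\<lambda>(k, d). (Hs ! k) $$ (min d (n - 1), d - min d (n - 1)))"
  have "hankel_of n x k = Hs ! k" if "k < r" for k
  proof -
    have H: "hankel_mat n (Hs ! k)" using Hs(1,2) that by auto
    show ?thesis
    proof (rule eq_matI)
      fix i j assume "i < dim_row (Hs ! k)" "j < dim_col (Hs ! k)"
      hence ij: "i < n" "j < n" using H unfolding hankel_mat_def by auto
      have "min (i + j) (n - 1) < n" "i + j - min (i + j) (n - 1) < n"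
        "i + j = min (i + j) (n - 1) + (i + j - min (i + j) (n - 1))" using ij by auto
      with H ij have "(Hs ! k) $$ (i, j) = (Hs ! k) $$ (min (i + j) (n - 1), i + j - min (i + j) (n - 1))"
        unfolding hankel_mat_def by blast
      thus "hankel_of n x k $$ (i, j) = (Hs ! k) $$ (i, j)" using ij by (simp add: hankel_of_def x_def)
    qed (use H in \<open>auto simp: hankel_mat_def hankel_of_def\<close>)
  qed
  hence "Hs = map (hankel_of n x) [0..<r]"
    using Hs(1) by (intro nth_equalityI) auto
  hence "A = factor_prod n (hankel_of n x) r"
    using Hs(3) foldr_eq_factor_prod[of "hankel_of n x" n r, OF hankel_of_carrier] by simp
  thus "\<exists>x. A = factor_prod n (hankel_of n x) r" by (rule exI[of _ x])
next
  assume "\<exists>x. A = factor_prod n (hankel_of n x) r"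
  then obtain x where A: "A = factor_prod n (hankel_of n x) r" ..
  have "hankel_mat n (hankel_of n x k)" for k by (simp add: hankel_mat_def hankel_of_def)
  thus "hankel_product n r A"
    unfolding hankel_product_def A
    by (intro exI[of _ "map (hankel_of n x) [0..<r]"]) (auto simp: foldr_eq_factor_prod)
qed

text \<open>
  The embedding \<open>g\<close> places the antidiagonal values among the variables.
\<close>

lemma poly_fun_hankel_factor_prod:
  assumes "i < n" "j < n" and inV: "\<And>k d. k < r \<Longrightarrow> d < 2 * n - 1 \<Longrightarrow> g (k, d) \<in> V"
  shows "poly_fun V (\<lambda>x. factor_prod n (hankel_of n (\<lambda>kd. x (g kd))) r $$ (i, j))"
  using assms
proof (induction r arbitrary: i j)
  case 0
  thus ?case by (simp add: poly_fun.const)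
next
  case (Suc r)
  have "factor_prod n (hankel_of n (\<lambda>kd. x (g kd))) (Suc r) $$ (i, j) =
      (\<Sum>l<n. factor_prod n (hankel_of n (\<lambda>kd. x (g kd))) r $$ (i, l) * x (g (r, l + j)))" for x
    unfolding factor_prod.simps
      mat_mult_entry[OF factor_prod_carrier[OF hankel_of_carrier] hankel_of_carrier Suc.prems(1,2)]
    using Suc.prems by (intro sum.cong) (simp_all add: hankel_of_entry)
  moreover have "poly_fun V (\<lambda>x. \<Sum>l<n. factor_prod n (hankel_of n (\<lambda>kd. x (g kd))) r $$ (i, l) * x (g (r, l + j)))"
    using Suc.prems by (intro poly_fun_sum poly_fun.mult Suc.IH poly_fun.var) auto
  ultimately show ?case by simp
qed

text \<open>
  Each parameter occurs in one factor only, and linearly there.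
\<close>

lemma hankel_factor_prod_affine:
  assumes "i < n" "j < n"
  shows "\<exists>a b. \<forall>t. factor_prod n (hankel_of n (x((k, d) := t))) r $$ (i, j) = a + t * b"
proof -
  have prod: "factor_prod n (hankel_of n z) (Suc r) $$ (i, j) =
      (\<Sum>l<n. factor_prod n (hankel_of n z) r $$ (i, l) * z (r, l + j))" if "i < n" "j < n" for z r i j
    unfolding factor_prod.simps mat_mult_entry[OF factor_prod_carrier[OF hankel_of_carrier] hankel_of_carrier that]
    using that by (intro sum.cong) (simp_all add: hankel_of_entry)
  have const: "factor_prod n (hankel_of n (x((k, d) := t))) r $$ (i, j) = factor_prod n (hankel_of n x) r $$ (i, j)"
    if "r \<le> k" "i < n" "j < n" for r i j t
    using that by (induction r arbitrary: j) (simp_all add: prod del: factor_prod.simps(2))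
  show ?thesis
    using assms
  proof (induction r arbitrary: i j)
    case 0
    thus ?case by (intro exI[of _ "1\<^sub>m n $$ (i, j)"] exI[of _ 0]) simp
  next
    case (Suc r)
    show ?case
    proof (cases "r = k")
      case True
      have "factor_prod n (hankel_of n (x((k, d) := t))) (Suc r) $$ (i, j) =
        (\<Sum>l<n. factor_prod n (hankel_of n x) r $$ (i, l) * (if l + j = d then 0 else x (r, l + j))) +
        t * (\<Sum>l<n. factor_prod n (hankel_of n x) r $$ (i, l) * (if l + j = d then 1 else 0))" for t
        unfolding prod[OF Suc.prems] sum_distrib_left sum.distrib[symmetric]
        using Suc.prems True by (intro sum.cong) (auto simp: const)
      thus ?thesis by blast
    next
      case False
      have "\<forall>l. \<exists>ab. l < n \<longrightarrow> (\<forall>t. factor_prod n (hankel_of n (x((k, d) := t))) r $$ (i, l) = fst ab + t * snd ab)"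
        using Suc.IH[OF Suc.prems(1)] by (metis fst_conv snd_conv)
      from choice[OF this] obtain ab where ab: "\<And>l t. l < n \<Longrightarrow>
        factor_prod n (hankel_of n (x((k, d) := t))) r $$ (i, l) = fst (ab l) + t * snd (ab l)" by blast
      have "factor_prod n (hankel_of n (x((k, d) := t))) (Suc r) $$ (i, j) =
        (\<Sum>l<n. fst (ab l) * x (r, l + j)) + t * (\<Sum>l<n. snd (ab l) * x (r, l + j))" for t
        unfolding prod[OF Suc.prems] sum_distrib_left sum.distrib[symmetric]
        using False by (intro sum.cong) (auto simp: ab algebra_simps)
      thus ?thesis by blast
    qed
  qed
qed

section \<open>Algebraic dependence by counting\<close>

lemma homogeneous_system_nontrivial_solution:
  fixes a :: "'e \<Rightarrow> 'b \<Rightarrow> complex"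
  assumes "finite B" "finite E" "card B < card E"
  shows "\<exists>u. (\<exists>e\<in>E. u e \<noteq> 0) \<and> (\<forall>b\<in>B. (\<Sum>e\<in>E. u e * a e b) = 0)"
  using assms
proof (induction B arbitrary: E a rule: finite_induct)
  case empty
  hence "E \<noteq> {}" by auto
  thus ?case by (intro exI[of _ "\<lambda>_. 1"]) auto
next
  case (insert b B)
  show ?case
  proof (cases "\<forall>e\<in>E. a e b = 0")
    case True
    have "card B < card E" using insert by simp
    from insert.IH[OF insert.prems(1) this, of a] obtain u where
      "\<exists>e\<in>E. u e \<noteq> 0" "\<forall>b\<in>B. (\<Sum>e\<in>E. u e * a e b) = 0" by blast
    thus ?thesis using True by (intro exI[of _ u]) auto
  next
    case False
    then obtain e0 where e0: "e0 \<in> E" "a e0 b \<noteq> 0" by blast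
    define a' where "a' e c = a e c - a e b / a e0 b * a e0 c" for e c
    have "card B < card (E - {e0})" using insert e0 by simp
    from insert.IH[OF _ this, of a'] insert.prems(1) obtain u where
      u: "\<exists>e\<in>E - {e0}. u e \<noteq> 0" "\<forall>c\<in>B. (\<Sum>e\<in>E - {e0}. u e * a' e c) = 0" by blast
    define w where "w = u(e0 := - (\<Sum>e\<in>E - {e0}. u e * (a e b / a e0 b)))"
    have split: "(\<Sum>e\<in>E. w e * a e c) = (\<Sum>e\<in>E - {e0}. u e * a' e c)" for c
    proof -
      have "(\<Sum>e\<in>E. w e * a e c) = w e0 * a e0 c + (\<Sum>e\<in>E - {e0}. u e * a e c)"
        using insert.prems(1) e0 by (subst sum.remove[of _ e0]) (auto simp: w_def intro!: sum.cong)
      thus ?thesis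
        by (simp add: w_def a'_def right_diff_distrib sum_subtractf sum_distrib_right mult.assoc)
    qed
    have "(\<Sum>e\<in>E. w e * a e c) = 0" if "c \<in> insert b B" for c
      unfolding split using that u(2) e0(2) by (auto simp: a'_def)
    moreover have "\<exists>e\<in>E. w e \<noteq> 0" using u(1) by (auto simp: w_def)
    ultimately show ?thesis by blast
  qed
qed

text \<open>
  In each variable separately, a polynomial of degree at most \<open>D\<close> with the \<open>D + 1\<close> roots
  \<open>0, \<dots>, D\<close> is zero; the variables are freed from the grid one after the other.
\<close>

lemma zero_if_zero_on_grid:
  fixes g :: "('v \<Rightarrow> complex) \<Rightarrow> complex"
  assumes "finite P"
    and deg: "\<And>v x. v \<in> P \<Longrightarrow> \<exists>p. degree p \<le> D \<and> (\<forall>t. g (x(v := t)) = poly p t)"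
    and grid: "\<And>x. (\<And>v. v \<in> P \<Longrightarrow> x v \<in> of_nat ` {..D}) \<Longrightarrow> g x = 0"
  shows "g x = 0"
proof -
  have "g x = 0" if "Q \<subseteq> P" "\<And>v. v \<in> P - Q \<Longrightarrow> x v \<in> of_nat ` {..D}" for Q x
    using finite_subset[OF that(1) assms(1)] that
  proof (induction Q arbitrary: x rule: finite_induct)
    case empty
    thus ?case by (intro grid) auto
  next
    case (insert v Q)
    obtain p where p: "degree p \<le> D" "\<And>t. g (x(v := t)) = poly p t"
      using deg[of v x] insert.prems(1) by blast
    have "p = 0"
    proof (rule ccontr)
      assume "p \<noteq> 0"
      have "poly p t = 0" if "t \<in> of_nat ` {..D}" for t
        unfolding p(2)[symmetric]
        by (rule insert.IH) (use insert.prems insert.hyps that in auto)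
      hence "of_nat ` {..D} \<subseteq> {t. poly p t = 0}" by auto
      hence "card (of_nat ` {..D} :: complex set) \<le> card {t. poly p t = 0}"
        using poly_roots_finite[OF \<open>p \<noteq> 0\<close>] by (intro card_mono)
      also have "\<dots> \<le> degree p" using \<open>p \<noteq> 0\<close> by (rule card_poly_roots_bound)
      finally show False using p(1) by (simp add: card_image inj_on_def)
    qed
    thus ?case using p(2)[of "x v"] by simp
  qed
  from this[of P] show ?thesis by simp
qed

lemma sum_digits:
  fixes e q :: nat
  shows "(\<Sum>j<K. q ^ j * (e div q ^ j mod q)) = e mod q ^ K"
proof (induction K)
  case (Suc K)
  have "e mod q ^ Suc K = q ^ K * (e div q ^ K mod q) + e mod q ^ K"
    unfolding power_Suc2 by (rule mod_mult2_eq)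
  thus ?case using Suc by simp
qed simp

text \<open>
  The left side counts the grid points, which grow like \<open>q ^ N\<close>, and the right side counts the
  monomials of degree below \<open>q\<close> in each of \<open>K > N\<close> variables; \<open>q = K ^ N + 1\<close> is large enough.
\<close>

lemma exists_power_exceeding:
  fixes K N :: nat
  assumes "N < K"
  shows "\<exists>q>0. (K * (q - 1) + 1) ^ N < q ^ K"
proof (intro exI conjI)
  let ?q = "K ^ N + 1"
  have "(K * (?q - 1) + 1) ^ N \<le> (K * ?q) ^ N" using assms by (intro power_mono) auto
  also have "\<dots> = K ^ N * ?q ^ N" by (rule power_mult_distrib)
  also have "\<dots> < ?q * ?q ^ N" by simp
  also have "\<dots> = ?q ^ Suc N" by simp
  also have "\<dots> \<le> ?q ^ K" using assms by (intro power_increasing) auto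
  finally show "(K * (?q - 1) + 1) ^ N < ?q ^ K" .
qed simp

text \<open>
  Look for a linear relation between the monomials in the \<open>\<rho> j\<close> with all exponents below \<open>q\<close>. By
  \<open>zero_if_zero_on_grid\<close> such a relation holds identically as soon as it holds on a finite grid, and
  for large \<open>q\<close> there are more monomials than grid points.
\<close>

lemma algebraically_dependent:
  fixes \<rho> :: "nat \<Rightarrow> ('v \<Rightarrow> complex) \<Rightarrow> complex"
  assumes P: "finite P" "card P < K"
    and dep: "\<And>j x y. j < K \<Longrightarrow> (\<And>v. v \<in> P \<Longrightarrow> x v = y v) \<Longrightarrow> \<rho> j x = \<rho> j y"
    and affine: "\<And>j v x. j < K \<Longrightarrow> v \<in> P \<Longrightarrow> \<exists>a b. \<forall>t. \<rho> j (x(v := t)) = a + t * b"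
  shows "\<exists>G y. poly_fun {..<K} G \<and> G y \<noteq> 0 \<and> (\<forall>x. G (\<lambda>j. \<rho> j x) = 0)"
proof -
  obtain q where q: "q > 0" "(K * (q - 1) + 1) ^ card P < q ^ K"
    using exists_power_exceeding[OF P(2)] by blast
  define D where "D = K * (q - 1)"
  \<comment> \<open>The exponents of the monomial with number \<open>e\<close> are the digits of \<open>e\<close> in base \<open>q\<close>.\<close>
  define m where "m e y = (\<Prod>j<K. y j ^ (e div q ^ j mod q))" for e and y :: "nat \<Rightarrow> complex"
  define X where "X = (P \<rightarrow>\<^sub>E (of_nat ` {..D} :: complex set))"
  have "card X = (D + 1) ^ card P"
    using P(1) by (simp add: X_def card_PiE card_image inj_on_def)
  moreover have "finite X" using P(1) by (auto simp: X_def intro!: finite_PiE)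
  ultimately obtain u where u: "\<exists>e\<in>{..<q ^ K}. u e \<noteq> 0"
    "\<forall>x\<in>X. (\<Sum>e<q ^ K. u e * m e (\<lambda>j. \<rho> j x)) = 0"
    using homogeneous_system_nontrivial_solution[of X "{..<q ^ K}" "\<lambda>e x. m e (\<lambda>j. \<rho> j x)"] q(2)
    unfolding D_def by auto
  define G where "G y = (\<Sum>e<q ^ K. u e * m e y)" for y
  have "poly_fun {..<K} G"
    unfolding G_def m_def
    by (intro poly_fun_sum poly_fun.mult poly_fun.const poly_fun_prod poly_fun_power poly_fun.var) auto
  moreover have "\<exists>y. G y \<noteq> 0"
  proof -
    \<comment> \<open>Kronecker's substitution \<open>y j = t ^ (q ^ j)\<close> maps the monomial with number \<open>e\<close> to \<open>t ^ e\<close>, so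
      that distinct monomials stay distinct.\<close>
    define p where "p = (\<Sum>e<q ^ K. monom (u e) e)"
    have "m e (\<lambda>j. t ^ (q ^ j)) = t ^ e" if "e < q ^ K" for e t
    proof -
      have "m e (\<lambda>j. t ^ (q ^ j)) = t ^ (\<Sum>j<K. q ^ j * (e div q ^ j mod q))"
        by (simp add: m_def power_sum power_mult)
      thus ?thesis using that by (simp add: sum_digits)
    qed
    hence G: "G (\<lambda>j. t ^ (q ^ j)) = poly p t" for t
      by (simp add: G_def p_def poly_sum poly_monom)
    from u(1) obtain e where e: "e < q ^ K" "u e \<noteq> 0" by auto
    have "coeff p e = (\<Sum>e'<q ^ K. if e' = e then u e' else 0)"
      by (simp add: p_def coeff_sum)
    also have "\<dots> = u e" using e(1) by simp
    finally have "p \<noteq> 0" using e(2) by auto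
    then obtain t where "poly p t \<noteq> 0" using poly_all_0_iff_0 by blast
    thus ?thesis using G by metis
  qed
  moreover have "G (\<lambda>j. \<rho> j x) = 0" for x
  proof (rule zero_if_zero_on_grid[of P D "\<lambda>x. G (\<lambda>j. \<rho> j x)"])
    fix v and x :: "'v \<Rightarrow> complex" assume v: "v \<in> P"
    have "\<forall>j. \<exists>p. j < K \<longrightarrow> degree p \<le> 1 \<and> (\<forall>t. \<rho> j (x(v := t)) = poly p t)"
    proof
      fix j
      show "\<exists>p. j < K \<longrightarrow> degree p \<le> 1 \<and> (\<forall>t. \<rho> j (x(v := t)) = poly p t)"
      proof (cases "j < K")
        case True
        from affine[OF this v, of x] obtain a b where "\<forall>t. \<rho> j (x(v := t)) = a + t * b" by blast
        thus ?thesis by (intro exI[of _ "[:a, b:]"]) auto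
      qed simp
    qed
    from choice[OF this] obtain p where
      p: "\<And>j. j < K \<Longrightarrow> degree (p j) \<le> 1" "\<And>j t. j < K \<Longrightarrow> \<rho> j (x(v := t)) = poly (p j) t" by blast
    let ?p = "\<Sum>e<q ^ K. smult (u e) (\<Prod>j<K. p j ^ (e div q ^ j mod q))"
    have "degree (p j ^ (e div q ^ j mod q)) \<le> q - 1" if "j < K" for j e
    proof -
      have "degree (p j ^ (e div q ^ j mod q)) \<le> degree (p j) * (e div q ^ j mod q)"
        by (rule degree_power_le)
      also have "\<dots> \<le> 1 * (q - 1)"
        using p(1)[OF that] q(1) by (intro mult_mono) (auto simp: less_Suc_eq_le[symmetric])
      finally show ?thesis by simp
    qed
    hence "(\<Sum>j<K. degree (p j ^ (e div q ^ j mod q))) \<le> D" for e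
      using sum_bounded_above[of "{..<K}" "\<lambda>j. degree (p j ^ (e div q ^ j mod q))" "q - 1"]
      by (simp add: D_def)
    hence "degree (\<Prod>j<K. p j ^ (e div q ^ j mod q)) \<le> D" for e
      using degree_prod_sum_le[of "{..<K}" "\<lambda>j. p j ^ (e div q ^ j mod q)"] order_trans
      by (simp add: comp_def) blast
    hence "degree ?p \<le> D"
      by (intro degree_sum_le) (auto intro: order_trans[OF degree_smult_le])
    moreover have "G (\<lambda>j. \<rho> j (x(v := t))) = poly ?p t" for t
      by (simp add: G_def m_def poly_sum poly_prod poly_power p(2))
    ultimately show "\<exists>p. degree p \<le> D \<and> (\<forall>t. G (\<lambda>j. \<rho> j (x(v := t))) = poly p t)" by blast
  next
    fix x :: "'v \<Rightarrow> complex" assume "\<And>v. v \<in> P \<Longrightarrow> x v \<in> of_nat ` {..D}"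
    hence "restrict x P \<in> X" by (auto simp: X_def)
    hence "G (\<lambda>j. \<rho> j (restrict x P)) = 0" using u(2) by (simp add: G_def)
    moreover have "G (\<lambda>j. \<rho> j x) = G (\<lambda>j. \<rho> j (restrict x P))"
      unfolding G_def m_def by (intro sum.cong prod.cong refl arg_cong2[of _ _ _ _ "(*)"] arg_cong2[of _ _ _ _ "(^)"] dep) auto
    ultimately show "G (\<lambda>j. \<rho> j x) = 0" by simp
  qed (rule P(1))
  ultimately show ?thesis by blast
qed

section \<open>Generic matrices\<close>

lemma every_generic_mat_iff:
  "every_generic_mat n P \<longleftrightarrow> (\<exists>f. mat_polynomial_function n f \<and> (\<exists>A \<in> carrier_mat n n. f A \<noteq> 0) \<and>
     (\<forall>A \<in> carrier_mat n n. f A \<noteq> 0 \<longrightarrow> P A))" (is "_ \<longleftrightarrow> ?R")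
proof
  let ?S = "{A \<in> carrier_mat n n. \<not> P A}"
  assume "every_generic_mat n P"
  hence sub: "zariski_closure n ?S \<subset> carrier_mat n n" by (simp add: every_generic_mat_def)
  have "zariski_closed n (zariski_closure n ?S)" by (rule zariski_closed_closure) auto
  then obtain F where F: "\<And>f. f \<in> F \<Longrightarrow> mat_polynomial_function n f"
    "zariski_closure n ?S = {A \<in> carrier_mat n n. \<forall>f \<in> F. f A = 0}"
    unfolding zariski_closed_def by auto
  from sub obtain A where A: "A \<in> carrier_mat n n" "A \<notin> zariski_closure n ?S" by auto
  then obtain f where f: "f \<in> F" "f A \<noteq> 0" unfolding F(2) by auto
  have "?S \<subseteq> zariski_closure n ?S" unfolding zariski_closure_def by (rule hull_subset)
  hence "\<forall>B \<in> carrier_mat n n. f B \<noteq> 0 \<longrightarrow> P B" using f(1) unfolding F(2) by blast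
  thus ?R using F(1)[OF f(1)] f(2) A(1) by blast
next
  let ?S = "{A \<in> carrier_mat n n. \<not> P A}"
  assume ?R
  then obtain f A where f: "mat_polynomial_function n f" "A \<in> carrier_mat n n" "f A \<noteq> 0"
    "\<forall>A \<in> carrier_mat n n. f A \<noteq> 0 \<longrightarrow> P A" by blast
  let ?Z = "{A \<in> carrier_mat n n. f A = 0}"
  have "zariski_closed n ?Z"
    unfolding zariski_closed_def by (rule exI[of _ "{f}"]) (use f(1) in auto)
  moreover have "?S \<subseteq> ?Z" using f(4) by blast
  ultimately have "zariski_closure n ?S \<subseteq> ?Z"
    unfolding zariski_closure_def by (intro hull_minimal)
  thus "every_generic_mat n P"
    unfolding every_generic_mat_def using f(2,3) by blast
qed

lemma poly_fun_imp_mat_polynomial_function: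
  assumes "poly_fun V f" "\<And>v. v \<in> V \<Longrightarrow> mat_polynomial_function n (\<lambda>A. env A v)"
  shows "mat_polynomial_function n (\<lambda>A. f (env A))"
  using assms(1) by induction (auto intro: mat_polynomial_function.intros assms(2))

lemma mat_polynomial_function_imp_poly_fun:
  assumes "mat_polynomial_function n f"
  shows "poly_fun UNIV (\<lambda>x. f (mat n n (\<lambda>(i, j). x (i * n + j))))"
  using assms by induction (auto intro: poly_fun.intros)

text \<open>
  The products are the matrices for which parameters with the prescribed product exist; eliminating
  the parameters makes this condition constructible, and \<open>hankel_products_dense\<close> decides the dichotomy.
\<close>

lemma generic_mat_is_hankel_product:
  "every_generic_mat n (hankel_product n (n div 2 + 1))"
proof -
  define r where "r = n div 2 + 1"
  let ?C = "{..<n} \<times> {..<n}" and ?P = "{..<r} \<times> {..<2 * n - 1}"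
  let ?V = "Inl ` ?C \<union> Inr ` ?P :: (nat \<times> nat + nat \<times> nat) set"
  let ?F = "\<lambda>x :: nat \<times> nat + nat \<times> nat \<Rightarrow> complex. factor_prod n (hankel_of n (\<lambda>kd. x (Inr kd))) r"
  define \<phi> where "\<phi> x \<longleftrightarrow> (\<forall>ij\<in>?C. x (Inl ij) - ?F x $$ ij = 0)" for x
  define \<psi> where "\<psi> x \<longleftrightarrow> (\<exists>y. \<phi> (\<lambda>v. if v \<in> Inr ` ?P then y v else x v))" for x
  have polyF: "poly_fun V (\<lambda>x. ?F x $$ (i, j))" if "i < n" "j < n" "Inr ` ?P \<subseteq> V" for i j V
    by (rule poly_fun_hankel_factor_prod[OF that(1,2)]) (use that(3) in auto)
  have "constructible ?V \<phi>"
    unfolding \<phi>_def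
  proof (rule constructible_Ball)
    fix ij assume "ij \<in> ?C"
    thus "constructible ?V (\<lambda>x. x (Inl ij) - ?F x $$ ij = 0)"
      by (cases ij) (use polyF in \<open>auto intro!: constructible.eq poly_fun_minus poly_fun.var simp del: right_minus_eq\<close>)
  qed simp
  hence "constructible (?V - Inr ` ?P) \<psi>"
    unfolding \<psi>_def by (intro constructible_ex_finite) auto
  moreover have "?V - Inr ` ?P = Inl ` ?C" by auto
  ultimately have "constructible (Inl ` ?C) \<psi>" by simp
  from constructible_generic_dichotomy[OF this] obtain f x0 where
    f: "poly_fun (Inl ` ?C) f" "f x0 \<noteq> 0" and
    dich: "(\<forall>x. f x \<noteq> 0 \<longrightarrow> \<psi> x) \<or> (\<forall>x. f x \<noteq> 0 \<longrightarrow> \<not> \<psi> x)" by (elim exE conjE)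
  have \<psi>_intro: "\<psi> x" if A: "hankel_product n r A" and
    xA: "\<And>i j. i < n \<Longrightarrow> j < n \<Longrightarrow> x (Inl (i, j)) = A $$ (i, j)" for x A
  proof -
    from A obtain y where y: "A = factor_prod n (hankel_of n y) r" unfolding hankel_product_iff ..
    let ?y = "\<lambda>v. case v of Inl _ \<Rightarrow> 0 | Inr kd \<Rightarrow> y kd"
    let ?x = "\<lambda>v. if v \<in> Inr ` ?P then ?y v else x v"
    have "?F ?x $$ (i, j) = ?F ?y $$ (i, j)" if "i < n" "j < n" for i j
      by (rule poly_fun_cong_vars[OF polyF[OF that order_refl]]) auto
    hence "\<phi> ?x" unfolding \<phi>_def using xA by (auto simp: y)
    thus ?thesis unfolding \<psi>_def by (rule exI[of _ ?y])
  qed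
  have \<psi>_elim: "hankel_product n r A" if "\<psi> x" and A: "A \<in> carrier_mat n n" and
    xA: "\<And>i j. i < n \<Longrightarrow> j < n \<Longrightarrow> x (Inl (i, j)) = A $$ (i, j)" for x A
  proof -
    from \<open>\<psi> x\<close> obtain y where "\<phi> (\<lambda>v. if v \<in> Inr ` ?P then y v else x v)" unfolding \<psi>_def ..
    then obtain z where z: "\<phi> z" "\<And>ij. z (Inl ij) = x (Inl ij)" by force
    have "A $$ (i, j) = ?F z $$ (i, j)" if "i < n" "j < n" for i j
      using bspec[OF z(1)[unfolded \<phi>_def], of "(i, j)"] that xA[OF that] z(2) by simp
    hence "A = ?F z"
      using A carrier_matD[OF factor_prod_carrier[OF hankel_of_carrier]]
      by (intro eq_matI) auto
    thus ?thesis unfolding hankel_product_iff by (rule exI[of _ "\<lambda>kd. z (Inr kd)"])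
  qed
  have good: "\<psi> x" if "f x \<noteq> 0" for x
  proof (rule ccontr)
    assume "\<not> \<psi> x"
    hence none: "\<And>x. f x \<noteq> 0 \<Longrightarrow> \<not> \<psi> x" using dich that by blast
    have "f x0 = 0"
      by (rule hankel_products_dense[OF f(1)]) (use none \<psi>_intro in \<open>unfold r_def, blast\<close>)
    thus False using f(2) by simp
  qed
  define env :: "complex mat \<Rightarrow> nat \<times> nat + nat \<times> nat \<Rightarrow> complex" where
    "env A v = (case v of Inl ij \<Rightarrow> A $$ ij | Inr _ \<Rightarrow> 0)" for A v
  let ?A0 = "mat n n (\<lambda>ij. x0 (Inl ij))"
  have "mat_polynomial_function n (\<lambda>A. f (env A))"
    by (rule poly_fun_imp_mat_polynomial_function[OF f(1)])
      (auto simp: env_def intro: mat_polynomial_function.entry)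
  moreover have "f (env ?A0) = f x0"
    by (rule poly_fun_cong_vars[OF f(1)]) (auto simp: env_def)
  moreover have "hankel_product n r A" if "A \<in> carrier_mat n n" "f (env A) \<noteq> 0" for A
    by (rule \<psi>_elim[OF good[OF that(2)] that(1)]) (simp add: env_def)
  ultimately show ?thesis
    unfolding every_generic_mat_iff r_def[symmetric] using f(2)
    by (intro exI[of _ "\<lambda>A. f (env A)"] conjI bexI[of _ ?A0]) auto
qed

text \<open>
  Otherwise the open set of matrices guaranteed to be products would meet the complement of the
  hypersurface that contains all products.
\<close>

lemma generic_hankel_product_length_bound:
  assumes "n \<ge> 1" and gen: "every_generic_mat n (hankel_product n s)"
  shows "n div 2 < s"
proof (rule ccontr)
  assume "\<not> n div 2 < s"
  hence "2 * s \<le> n" by linarith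
  hence "2 * s * n \<le> n * n" by (rule mult_right_mono) simp
  hence bound: "s * (2 * n) \<le> n * n" by (simp add: mult_ac)
  have count: "s * (2 * n - 1) < n * n"
  proof (cases "s = 0")
    case False
    hence "s * (2 * n - 1) < s * (2 * n)" using assms(1) by simp
    thus ?thesis using bound by linarith
  qed (use assms(1) in simp)
  define \<rho> where "\<rho> j x = factor_prod n (hankel_of n x) s $$ (j div n, j mod n)" for j x
  have code: "j div n < n" "j mod n < n" if "j < n * n" for j
    using that assms(1) by (auto simp: less_mult_imp_div_less)
  let ?P = "{..<s} \<times> {..<2 * n - 1}"
  have "\<exists>G y. poly_fun {..<n * n} G \<and> G y \<noteq> 0 \<and> (\<forall>x. G (\<lambda>j. \<rho> j x) = 0)"
  proof (rule algebraically_dependent[of ?P])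
    fix j and x y :: "nat \<times> nat \<Rightarrow> complex"
    assume j: "j < n * n" and xy: "\<And>v. v \<in> ?P \<Longrightarrow> x v = y v"
    show "\<rho> j x = \<rho> j y"
      unfolding \<rho>_def
      by (rule poly_fun_cong_vars[OF poly_fun_hankel_factor_prod[OF code[OF j], where g = id and V = ?P, simplified]])
        (use xy in auto)
  next
    fix j v and x :: "nat \<times> nat \<Rightarrow> complex"
    assume "j < n * n"
    thus "\<exists>a b. \<forall>t. \<rho> j (x(v := t)) = a + t * b"
      unfolding \<rho>_def using hankel_factor_prod_affine[OF code] by (cases v) simp
  qed (use count in simp_all)
  then obtain G y where G: "poly_fun {..<n * n} G" "G y \<noteq> 0" "\<And>x. G (\<lambda>j. \<rho> j x) = 0" by (elim exE conjE) blast
  from gen[unfolded every_generic_mat_iff] obtain f A where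
    f: "mat_polynomial_function n f" "A \<in> carrier_mat n n" "f A \<noteq> 0"
    "\<And>A. A \<in> carrier_mat n n \<Longrightarrow> f A \<noteq> 0 \<Longrightarrow> hankel_product n s A" by blast
  let ?M = "\<lambda>x. mat n n (\<lambda>(i, j). x (i * n + j)) :: complex mat"
  have M: "?M x $$ (j div n, j mod n) = x j" if "j < n * n" for j x
    using code[OF that] by simp
  have "?M (\<lambda>k. A $$ (k div n, k mod n)) = A"
    using f(2) by (intro eq_matI) auto
  hence fA: "f (?M (\<lambda>k. A $$ (k div n, k mod n))) \<noteq> 0" using f(3) by simp
  have "poly_fun UNIV G" using G(1) by induction (auto intro: poly_fun.intros)
  from poly_fun_mult_nonzero[where f = "\<lambda>x. f (?M x)" and g = G,
      OF mat_polynomial_function_imp_poly_fun[OF f(1)] this fA G(2)]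
  obtain z where z: "f (?M z) \<noteq> 0" "G z \<noteq> 0" by auto
  have "hankel_product n s (?M z)" using z(1) by (intro f(4)) auto
  then obtain x where x: "?M z = factor_prod n (hankel_of n x) s" unfolding hankel_product_iff ..
  have "G z = G (\<lambda>j. \<rho> j x)"
    by (rule poly_fun_cong_vars[OF G(1)]) (use M[of _ z] in \<open>simp add: \<rho>_def flip: x\<close>)
  thus False using G(3) z(2) by simp
qed

theorem corollary4p4:
  fixes n :: nat
  assumes "n \<ge> 1"
  shows "every_generic_mat n (hankel_product n (n div 2 + 1)) \<and>
         (\<forall>s. every_generic_mat n (hankel_product n s) \<longrightarrow> n div 2 + 1 \<le> s)"
  using generic_mat_is_hankel_product[of n] generic_hankel_product_length_bound[OF assms]
  by (auto simp: Suc_le_eq)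

end
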